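(* Suppose that, in the setting of the context, the constants $\eta^*(p)$, $p\ge2$, can be chosen so that $$\liminf_{p\to\infty}\frac{p-1-\eta^*(p)}{\log p}=\infty,$$ and that, with this choice and $C_0(p):=2\sup_{a>0}a^{-(p-\eta^*(p))}\mathbb E(\xi^{(p)}(a))$, $$\sup_{p\ge2}\mathbb E[(v^{(p)})^2]<\infty,\qquad\sup_{p\ge2}\mathbb E[\xi^{(p)}(\infty)]<\infty,\qquad\sup_{p\ge2}C_0(p)<\infty.$$ Suppose also that for any $a\in(1,\infty)$, $\lim_{p\to\infty}\mathbb E(\xi^{(p)}(\infty)-\xi^{(p)}(a))=0$. Then for any $T>0$, $$\sup_{t\in[0,T]}\big|Q^{(p)}(t)-W^{(p)}_\infty(t)\big|\xrightarrow{P}0\quad\text{as }p\to\infty.$$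
   Context: Notation: $\mathbb R_+=[0,\infty)$; $\mathcal D([0,\infty):E)$ is the space of right-continuous functions with left limits with the Skorohod topology; $\delta_x^+$ denotes $\delta_x$ if $x>0$ and the zero measure if $x=0$. The Skorohod map is $\Gamma[f](t)=f(t)-\inf_{0\le s\le t}(f(s)\wedge 0)$. For every real $p\ge2$ we are given a sequence of queues indexed by $r\in\mathcal R$, where $\mathcal R\subset(1,\infty)$ is a sequence tending to infinity, as follows. Arrivals (not depending on $p$): $E^r(\cdot)$ is a delayed renewal process with independent interarrival times $T_1^r,T_2^r,\dots$; $T^r_i$, $i\ge2$, are i.i.d. copies of a positive $T^r$ with mean $1/\lambda^r$ and finite standard deviation $\sigma_A^r$; $T^r_1$ is positive and finite with finite second moment. Processing times: i.i.d. copies of $v^{(p)}>0$ with continuous distribution function $F^{(p)}$, $F^{(p)}(0)=0$, and $\overline F^{(p)}=1-F^{(p)}$ satisfies $\overline F^{(p)}(t)>0$ and $\lim_{x\to\infty}\overline F^{(p)}(tx)/\overline F^{(p)}(x)=t^{-(p+1)}$ for all $t>0$. Initial jobs: $\mathbf q^{(p),r}$ jobs (a nonnegative integer valued random variable) with strictly positive remaining processing times $\breve v^{(p),r}_l$, $1\le l\le\mathbf q^{(p),r}$, of a.s. finite sum. For each $p,r$ the initial data, $E^r$ and the processing times are mutually independent. Service is shortest-remaining-processing-time first: rate one, nonidling, preemptive. Heavy traffic: there are $\kappa\in\mathbb R$, $\lambda,\sigma_A\in(0,\infty)$, not depending on $p$, such that as $r\to\infty$, $r(\lambda^r\mathbb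 E(v^{(p)})-1)\to\kappa$, $\lambda^r\to\lambda$ (hence $\mathbb E(v^{(p)})=1/\lambda$ for all $p$), $\sigma_A^r\to\sigma_A$, $\limsup_r\mathbb E(T_1^r)\le\lambda^{-1}$, $\limsup_r\big(\operatorname{Var}(T^r_1)\vee\mathbb E[(T^r_1-(\lambda^r)^{-1})^2]\big)\le\sigma_A^2$, and $r^{-1}(E^r(r^2\cdot)-\lambda^rr^2\,\cdot)$ converges in distribution in $\mathcal D([0,\infty):\mathbb R)$ to a driftless Brownian motion from $0$ with variance $\lambda^3\sigma_A^2$ per unit time. Scaling: $S^{(p)}(x)=1/\mathbb E(v^{(p)}\mathbf 1_{[v^{(p)}>x]})$, $c^{(p),r}=\inf\{u>0:S^{(p)}(u)>r\}$ (considered for $r>S^{(p)}(0)$, so that $c^{(p),r}>0$), and the initial rescaled truncated workload is $W^{(p),r}_a(0)=\frac1r\sum_{l=1}^{\mathbf q^{(p),r}}\breve v^{(p),r}_l\mathbf 1_{[\breve v^{(p),r}_l\le ac^{(p),r}]}$, $a\in[0,\infty]$. Initial conditions, for each $p\ge2$: there is an $\mathbb R_+$-valued continuous nondecreasing process $(\xi^{(p)}(a))_{a\in\mathbb R_+}$ with $\xi^{(p)}(\infty)=\lim_{a\to\infty}\xi^{(p)}(a)$, $\mathbb E(\xi^{(p)}(\infty))<\infty$, such that $(W^{(p),r}_\cdot(0),W^{(p),r}_\infty(0))\xrightarrow{d}(\xi^{(p)}(\cdot),\xi^{(p)}(\infty))$ in $\mathcal D([0,\infty):\mathbb R_+)\times\mathbb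 R_+$ as $r\to\infty$; $\{W^{(p),r}_\infty(0)\}_r$ is uniformly integrable; there are $\eta^*(p)\in(0,p-1)$, $a^*(p)>0$, $\alpha^*(p)\in(0,p]$ such that $\limsup_{r\to\infty}\sup_{a\in[a^*(p)/c^{(p),r},1]}a^{-(p-\eta^*(p))}\mathbb E(W^{(p),r}_a(0))<\infty$ (this is the condition defining the admissible choices of $\eta^*(p)$; it implies $C_0(p)<\infty$) and $\limsup_{a\to\infty}a^{\alpha^*(p)}\mathbb E(\xi^{(p)}(\infty)-\xi^{(p)}(a))<\infty$; and for every $a\ge0$, $\frac{c^{(p),r}}{r}\sum_{l=1}^{\mathbf q^{(p),r}}\mathbf 1_{[\breve v^{(p),r}_l\le a]}\to0$ in probability as $r\to\infty$. Limit objects: $B$ is a standard Brownian motion independent of $(\xi^{(p)}(\cdot),\xi^{(p)}(\infty))$ for each $p$; $\sigma(p)=\sqrt{\lambda\operatorname{Var}(v^{(p)})+\lambda\sigma_A^2}$; $X^{(p)}_x(t)=\xi^{(p)}(x)+\sigma(p)B(t)+(\kappa-\lambda x^{-p})t$ for $0<x<\infty$; $X^{(p)}_\infty(t)=\xi^{(p)}(\infty)+\sigma(p)B(t)+\kappa t$; $W^{(p)}_x=\Gamma[X^{(p)}_x]$ for $x\in(0,\infty]$; and $Q^{(p)}(t)=\int_0^\infty x^{-2}W^{(p)}_x(t)\,dx$, $t\ge0$ (the limiting scaled queue length; $W_\infty^{(p)}$ is the limiting scaled workload). *)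

theory Defs
  imports "HOL-Probability.Probability"
begin

section \<open>The Skorohod space\<close>

text \<open>Paths on \<open>[0,\<infinity>)\<close> are functions on the reals that are \<^const>\<open>undefined\<close> off \<open>{0..}\<close>.\<close>

definition cadlag :: "real set \<Rightarrow> (real \<Rightarrow> real) set" where
  "cadlag E = {x \<in> {0..} \<rightarrow>\<^sub>E E.
     \<forall>t\<ge>0. (x \<longlongrightarrow> x t) (at_right t) \<and> (0 < t \<longrightarrow> (\<exists>l\<in>E. (x \<longlongrightarrow> l) (at_left t)))}"

definition time_changes :: "(real \<Rightarrow> real) set" where
  "time_changes = {\<mu>. strict_mono_on {0..} \<mu> \<and> continuous_on {0..} \<mu> \<and> \<mu> ` {0..} = {0..}}"

definition skorohod_nbhd :: "real set \<Rightarrow> (real \<Rightarrow> real) \<Rightarrow> real \<Rightarrow> real \<Rightarrow> (real \<Rightarrow> real) set" where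
  "skorohod_nbhd E x K e =
     {y \<in> cadlag E. \<exists>\<mu>\<in>time_changes. \<forall>t\<in>{0..K}. \<bar>\<mu> t - t\<bar> < e \<and> \<bar>y t - x (\<mu> t)\<bar> < e}"

text \<open>The J1 topology. A sequence \<open>x\<^sub>n\<close> is eventually in every \<open>skorohod_nbhd E x K e\<close> iff for each
  \<open>K\<close> there are time changes \<open>\<mu>\<^sub>n\<close> with \<open>\<mu>\<^sub>n(t) - t\<close> and \<open>x\<^sub>n(t) - x(\<mu>\<^sub>n(t))\<close> tending to 0 uniformly
  on \<open>[0,K]\<close>, which is convergence in Skorohod's metric on \<open>D[0,\<infinity>)\<close> (Ethier and Kurtz,
  Markov Processes, Proposition 3.5.3). As that metric exists, the open sets are those below.\<close>

definition skorohod_topology :: "real set \<Rightarrow> (real \<Rightarrow> real) topology" where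
  "skorohod_topology E = topology (\<lambda>U. U \<subseteq> cadlag E \<and>
     (\<forall>x\<in>U. \<exists>K>0. \<exists>e>0. skorohod_nbhd E x K e \<subseteq> U))"

lemma skorohod_nbhd_mono:
  assumes "K \<le> K'" "e' \<le> e"
  shows "skorohod_nbhd E x K' e' \<subseteq> skorohod_nbhd E x K e"
proof
  fix y assume "y \<in> skorohod_nbhd E x K' e'"
  then obtain \<mu> where y: "y \<in> cadlag E" and \<mu>: "\<mu> \<in> time_changes"
    and *: "\<forall>t\<in>{0..K'}. \<bar>\<mu> t - t\<bar> < e' \<and> \<bar>y t - x (\<mu> t)\<bar> < e'"
    unfolding skorohod_nbhd_def by blast
  have "\<forall>t\<in>{0..K}. \<bar>\<mu> t - t\<bar> < e \<and> \<bar>y t - x (\<mu> t)\<bar> < e"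
    using * assms by force
  with y \<mu> show "y \<in> skorohod_nbhd E x K e"
    unfolding skorohod_nbhd_def by blast
qed

lemma openin_skorohod_topology:
  "openin (skorohod_topology E) U \<longleftrightarrow>
     U \<subseteq> cadlag E \<and> (\<forall>x\<in>U. \<exists>K>0. \<exists>e>0. skorohod_nbhd E x K e \<subseteq> U)"
proof -
  let ?P = "\<lambda>U. U \<subseteq> cadlag E \<and> (\<forall>x\<in>U. \<exists>K>0. \<exists>e>0. skorohod_nbhd E x K e \<subseteq> U)"
  have "istopology ?P"
    unfolding istopology_def
  proof (intro conjI allI impI ballI)
    fix S T x assume S: "?P S" and T: "?P T" and x: "x \<in> S \<inter> T"
    obtain K1 e1 where 1: "K1 > 0" "e1 > 0" "skorohod_nbhd E x K1 e1 \<subseteq> S" using S x by blast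
    obtain K2 e2 where 2: "K2 > 0" "e2 > 0" "skorohod_nbhd E x K2 e2 \<subseteq> T" using T x by blast
    have "skorohod_nbhd E x (max K1 K2) (min e1 e2) \<subseteq> S \<inter> T"
      using skorohod_nbhd_mono[of K1 "max K1 K2" "min e1 e2" e1 E x]
        skorohod_nbhd_mono[of K2 "max K1 K2" "min e1 e2" e2 E x] 1 2 by auto
    then show "\<exists>K>0. \<exists>e>0. skorohod_nbhd E x K e \<subseteq> S \<inter> T"
      using 1 2 by (intro exI[of _ "max K1 K2"] conjI exI[of _ "min e1 e2"]) auto
  next
    fix \<K> x assume \<K>: "\<forall>S\<in>\<K>. ?P S" and "x \<in> \<Union>\<K>"
    then obtain S where S: "S \<in> \<K>" "x \<in> S" by blast
    then obtain K e where "K > 0" "e > 0" "skorohod_nbhd E x K e \<subseteq> S" using \<K> by blast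
    with S show "\<exists>K>0. \<exists>e>0. skorohod_nbhd E x K e \<subseteq> \<Union>\<K>" by blast
  qed blast+
  then show ?thesis
    unfolding skorohod_topology_def by (simp add: topology_inverse')
qed

lemma topspace_skorohod_topology [simp]: "topspace (skorohod_topology E) = cadlag E"
proof -
  have "openin (skorohod_topology E) (cadlag E)"
    unfolding openin_skorohod_topology
    by (intro conjI ballI exI[of _ "1::real"]) (auto simp: skorohod_nbhd_def)
  then show ?thesis
    unfolding topspace_def using openin_skorohod_topology by fast
qed


section \<open>Modes of convergence\<close>

definition borel_of :: "'a topology \<Rightarrow> 'a measure" where
  "borel_of X = sigma (topspace X) {U. openin X U}"

text \<open>The approximating random elements may live on different probability spaces and are only
  required to be \<open>X\<close>-valued random elements up to null sets, whence the versions \<open>Y'\<close>.\<close>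

definition conv_in_distribution ::
  "'a topology \<Rightarrow> (nat \<Rightarrow> 'w measure) \<Rightarrow> (nat \<Rightarrow> 'w \<Rightarrow> 'a) \<Rightarrow> 'o measure \<Rightarrow> ('o \<Rightarrow> 'a) \<Rightarrow> bool" where
  "conv_in_distribution X N Y M Z \<longleftrightarrow>
     Z \<in> M \<rightarrow>\<^sub>M borel_of X \<and>
     (\<exists>Y'. (\<forall>n. Y' n \<in> N n \<rightarrow>\<^sub>M borel_of X \<and> (AE \<omega> in N n. Y n \<omega> = Y' n \<omega>)) \<and>
       (\<forall>f. continuous_map X euclideanreal f \<and> bounded (f ` topspace X) \<longrightarrow>
         (\<lambda>n. \<integral>\<omega>. f (Y' n \<omega>) \<partial>N n) \<longlonglongrightarrow> (\<integral>\<omega>. f (Z \<omega>) \<partial>M)))"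

text \<open>Convergence to 0 in probability of nonnegative extended real variables. The outer measure
  is the probability itself whenever the event is measurable with respect to the completion; it
  prevents the convention \<open>measure M A = 0\<close> for nonmeasurable \<open>A\<close> from playing a role.\<close>

definition conv_in_prob_0 ::
  "('i \<Rightarrow> 'w measure) \<Rightarrow> ('i \<Rightarrow> 'w \<Rightarrow> ereal) \<Rightarrow> 'i filter \<Rightarrow> bool" where
  "conv_in_prob_0 N Y F \<longleftrightarrow>
     (\<forall>e>0. ((\<lambda>i. outer_measure_of (N i) {\<omega> \<in> space (N i). ereal e < Y i \<omega>}) \<longlongrightarrow> 0) F)"

definition uniformly_integrable_seq :: "(nat \<Rightarrow> 'w measure) \<Rightarrow> (nat \<Rightarrow> 'w \<Rightarrow> real) \<Rightarrow> bool" where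
  "uniformly_integrable_seq N Y \<longleftrightarrow>
     ((\<lambda>K. SUP n. \<integral>\<^sup>+\<omega>. ennreal \<bar>Y n \<omega>\<bar> * indicator {\<omega>. K < \<bar>Y n \<omega>\<bar>} \<omega> \<partial>N n) \<longlongrightarrow> 0) at_top"


section \<open>Brownian motion and the Skorohod map\<close>

definition standard_BM :: "'o measure \<Rightarrow> (real \<Rightarrow> 'o \<Rightarrow> real) \<Rightarrow> bool" where
  "standard_BM M B \<longleftrightarrow>
     (\<forall>\<omega>\<in>space M. B 0 \<omega> = 0 \<and> continuous_on {0..} (\<lambda>t. B t \<omega>)) \<and>
     (\<forall>s t. 0 \<le> s \<and> s < t \<longrightarrow>
        distributed M lborel (\<lambda>\<omega>. B t \<omega> - B s \<omega>) (normal_density 0 (sqrt (t - s)))) \<and>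
     (\<forall>(t::nat \<Rightarrow> real) n. 0 \<le> t 0 \<and> strict_mono t \<longrightarrow>
        prob_space.indep_vars M (\<lambda>_. borel) (\<lambda>i \<omega>. B (t (Suc i)) \<omega> - B (t i) \<omega>) {..<n})"

definition skorohod_map :: "(real \<Rightarrow> real) \<Rightarrow> real \<Rightarrow> real" where
  "skorohod_map f t = f t - (INF s\<in>{0..t}. min (f s) 0)"


section \<open>Arrivals, processing times and the SRPT discipline\<close>

definition arrival_time :: "(nat \<Rightarrow> real) \<Rightarrow> nat \<Rightarrow> real" where
  "arrival_time T k = (\<Sum>i=1..k. T i)"

definition arrival_count :: "(nat \<Rightarrow> real) \<Rightarrow> real \<Rightarrow> real" where
  "arrival_count T t = real (card {k. 1 \<le> k \<and> arrival_time T k \<le> t})"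

text \<open>A processing time distribution is given by its law \<open>V\<close>.\<close>

definition law_mean :: "real measure \<Rightarrow> real" where
  "law_mean V = (\<integral>y. y \<partial>V)"

definition law_variance :: "real measure \<Rightarrow> real" where
  "law_variance V = (\<integral>y. (y - law_mean V)\<^sup>2 \<partial>V)"

definition S_fun :: "real measure \<Rightarrow> real \<Rightarrow> real" where
  "S_fun V x = 1 / (\<integral>y. y * indicator {x<..} y \<partial>V)"

definition c_fun :: "real measure \<Rightarrow> real \<Rightarrow> real" where
  "c_fun V r = Inf {u. 0 < u \<and> r < S_fun V u}"

text \<open>Only the first \<open>q\<close> entries of \<open>b\<close>, numbered from 1, are initial jobs.\<close>

definition init_work :: "real \<Rightarrow> nat \<Rightarrow> (nat \<Rightarrow> real) \<Rightarrow> ereal \<Rightarrow> real" where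
  "init_work r q b y = (1 / r) * (\<Sum>l=1..q. b l * of_bool (ereal (b l) \<le> y))"

definition init_data :: "nat \<Rightarrow> (nat \<Rightarrow> real) \<Rightarrow> nat \<times> (nat \<Rightarrow> real)" where
  "init_data q b = (q, \<lambda>l\<in>{1..}. if l \<le> q then b l else 0)"

abbreviation init_data_space :: "(nat \<times> (nat \<Rightarrow> real)) measure" where
  "init_data_space \<equiv> count_space UNIV \<Otimes>\<^sub>M (\<Pi>\<^sub>M l\<in>{1..}. borel)"

text \<open>\<open>srv s\<close> is the job in service at time \<open>s\<close>. A server of rate one reduces the remaining
  processing time of a job by the length of time spent on it.\<close>

definition remaining :: "('j \<Rightarrow> real) \<Rightarrow> (real \<Rightarrow> 'j option) \<Rightarrow> real \<Rightarrow> 'j \<Rightarrow> real" where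
  "remaining req srv t j = req j - measure lborel {s \<in> {0..t}. srv s = Some j}"

definition in_system ::
  "'j set \<Rightarrow> ('j \<Rightarrow> real) \<Rightarrow> ('j \<Rightarrow> real) \<Rightarrow> (real \<Rightarrow> 'j option) \<Rightarrow> real \<Rightarrow> 'j set" where
  "in_system J arr req srv t = {j \<in> J. arr j \<le> t \<and> 0 < remaining req srv t j}"

definition srpt_schedule ::
  "'j set \<Rightarrow> ('j \<Rightarrow> real) \<Rightarrow> ('j \<Rightarrow> real) \<Rightarrow> (real \<Rightarrow> 'j option) \<Rightarrow> bool" where
  "srpt_schedule J arr req srv \<longleftrightarrow>
     (\<forall>j. {s. 0 \<le> s \<and> srv s = Some j} \<in> sets borel) \<and>
     (\<forall>t\<ge>0. case srv t of
        None \<Rightarrow> in_system J arr req srv t = {}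
      | Some j \<Rightarrow> j \<in> in_system J arr req srv t \<and>
          (\<forall>k\<in>in_system J arr req srv t. remaining req srv t j \<le> remaining req srv t k))"

text \<open>Jobs are \<open>Inl l\<close> (initial) and \<open>Inr i\<close> (the \<open>i\<close>-th arrival).\<close>

definition srpt_queue ::
  "nat \<Rightarrow> (nat \<Rightarrow> real) \<Rightarrow> (nat \<Rightarrow> real) \<Rightarrow> (nat \<Rightarrow> real) \<Rightarrow> (real \<Rightarrow> (nat + nat) option) \<Rightarrow> bool" where
  "srpt_queue q b T v srv \<longleftrightarrow>
     srpt_schedule ({1..q} <+> {1..}) (case_sum (\<lambda>_. 0) (arrival_time T)) (case_sum b v) srv"


section \<open>The family of queues\<close>

text \<open>For the \<open>n\<close>-th index \<open>rs n\<close>, condition on an exponent \<open>\<eta>\<close>; \<open>N\<close>, \<open>q\<close>, \<open>b\<close> and the law \<open>V\<close>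
  belong to one fixed value of \<open>p\<close>.\<close>

definition admissible_eta ::
  "(nat \<Rightarrow> real) \<Rightarrow> (nat \<Rightarrow> 'w measure) \<Rightarrow> real measure \<Rightarrow> (nat \<Rightarrow> 'w \<Rightarrow> nat) \<Rightarrow>
   (nat \<Rightarrow> nat \<Rightarrow> 'w \<Rightarrow> real) \<Rightarrow> real \<Rightarrow> real \<Rightarrow> bool" where
  "admissible_eta rs N V q b p \<eta> \<longleftrightarrow> 0 < \<eta> \<and> \<eta> < p - 1 \<and>
     (\<exists>a0>0. limsup (\<lambda>n. SUP a\<in>{a0 / c_fun V (rs n)..1}. ennreal (a powr (- (p - \<eta>))) *
        (\<integral>\<^sup>+\<omega>. ennreal (init_work (rs n) (q n \<omega>) (\<lambda>l. b n l \<omega>)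
                        (ereal (a * c_fun V (rs n)))) \<partial>N n)) < \<infinity>)"

text \<open>\<open>rs\<close> enumerates the index sequence, and \<open>n\<close> stands for \<open>r = rs n\<close> in all other indices.
  All sequences of jobs are numbered from 1. Every \<open>N n\<close> carries the primitives of the \<open>n\<close>-th queue
  for all \<open>p\<close>; \<open>M\<close> carries the limit objects. Brownian motion with variance
  \<open>\<lambda>\<^sup>3\<sigma>\<^sub>A\<^sup>2\<close> is represented as a multiple of \<open>B\<close>, only its law being relevant.\<close>

locale srpt_family =
  fixes rs :: "nat \<Rightarrow> real"
    and N :: "nat \<Rightarrow> 'w measure"
    and T :: "nat \<Rightarrow> nat \<Rightarrow> 'w \<Rightarrow> real"
    and lamr sigAr :: "nat \<Rightarrow> real"
    and V :: "real \<Rightarrow> real measure"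
    and v :: "real \<Rightarrow> nat \<Rightarrow> nat \<Rightarrow> 'w \<Rightarrow> real"
    and q :: "real \<Rightarrow> nat \<Rightarrow> 'w \<Rightarrow> nat"
    and b :: "real \<Rightarrow> nat \<Rightarrow> nat \<Rightarrow> 'w \<Rightarrow> real"
    and srv :: "real \<Rightarrow> nat \<Rightarrow> 'w \<Rightarrow> real \<Rightarrow> (nat + nat) option"
    and \<kappa> lam sigA :: real
    and M :: "'o measure"
    and B :: "real \<Rightarrow> 'o \<Rightarrow> real"
    and xi :: "real \<Rightarrow> real \<Rightarrow> 'o \<Rightarrow> real"
    and xi_inf :: "real \<Rightarrow> 'o \<Rightarrow> real"
  assumes index_gt_1: "\<And>n. 1 < rs n"
    and index_lim: "filterlim rs at_top sequentially"
    and prob_space_N: "\<And>n. prob_space (N n)"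
    \<comment> \<open>arrivals\<close>
    and interarrival_indep: "\<And>n. prob_space.indep_vars (N n) (\<lambda>_. borel) (T n) {1..}"
    and interarrival_pos: "\<And>n i. 1 \<le> i \<Longrightarrow> AE \<omega> in N n. 0 < T n i \<omega>"
    and interarrival_ident:
      "\<And>n i. 2 \<le> i \<Longrightarrow> distr (N n) borel (T n i) = distr (N n) borel (T n 2)"
    and interarrival_sq: "\<And>n i. 1 \<le> i \<Longrightarrow> integrable (N n) (\<lambda>\<omega>. (T n i \<omega>)\<^sup>2)"
    and interarrival_mean: "\<And>n. 0 < lamr n \<and> prob_space.expectation (N n) (T n 2) = 1 / lamr n"
    and interarrival_sd: "\<And>n. sigAr n = sqrt (prob_space.variance (N n) (T n 2))"
    \<comment> \<open>processing times\<close>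
    and law_prob: "\<And>p. 2 \<le> p \<Longrightarrow> real_distribution (V p)"
    and law_cont: "\<And>p. 2 \<le> p \<Longrightarrow> continuous_on UNIV (cdf (V p))"
    and law_0: "\<And>p. 2 \<le> p \<Longrightarrow> cdf (V p) 0 = 0"
    and law_tail_pos: "\<And>p t. 2 \<le> p \<Longrightarrow> 0 < t \<Longrightarrow> 0 < 1 - cdf (V p) t"
    and law_tail_reg: "\<And>p t. 2 \<le> p \<Longrightarrow> 0 < t \<Longrightarrow>
      ((\<lambda>x. (1 - cdf (V p) (t * x)) / (1 - cdf (V p) x)) \<longlongrightarrow> t powr (- (p + 1))) at_top"
    and processing_indep:
      "\<And>p n. 2 \<le> p \<Longrightarrow> prob_space.indep_vars (N n) (\<lambda>_. borel) (v p n) {1..}"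
    and processing_law: "\<And>p n i. 2 \<le> p \<Longrightarrow> 1 \<le> i \<Longrightarrow> distr (N n) borel (v p n i) = V p"
    \<comment> \<open>initial jobs\<close>
    and init_meas: "\<And>p n. 2 \<le> p \<Longrightarrow>
      (\<lambda>\<omega>. init_data (q p n \<omega>) (\<lambda>l. b p n l \<omega>)) \<in> N n \<rightarrow>\<^sub>M init_data_space"
    and init_pos: "\<And>p n. 2 \<le> p \<Longrightarrow> AE \<omega> in N n. \<forall>l\<in>{1..q p n \<omega>}. 0 < b p n l \<omega>"
    and primitives_indep: "\<And>p n. 2 \<le> p \<Longrightarrow>
      prob_space.indep_sets (N n)
        (\<lambda>j::nat.
          if j = 0 then sets (vimage_algebra (space (N n))
            (\<lambda>\<omega>. init_data (q p n \<omega>) (\<lambda>l. b p n l \<omega>)) init_data_space)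
          else if j = 1 then sets (vimage_algebra (space (N n))
            (\<lambda>\<omega>. \<lambda>i\<in>{1..}. T n i \<omega>) (\<Pi>\<^sub>M i\<in>{1..}. borel))
          else sets (vimage_algebra (space (N n))
            (\<lambda>\<omega>. \<lambda>i\<in>{1..}. v p n i \<omega>) (\<Pi>\<^sub>M i\<in>{1..}. borel)))
        {0, 1, 2}"
    \<comment> \<open>service\<close>
    and service: "\<And>p n. 2 \<le> p \<Longrightarrow> AE \<omega> in N n.
      srpt_queue (q p n \<omega>) (\<lambda>l. b p n l \<omega>) (\<lambda>i. T n i \<omega>) (\<lambda>i. v p n i \<omega>) (srv p n \<omega>)"
    \<comment> \<open>heavy traffic\<close>
    and lam_pos: "0 < lam" and sigA_pos: "0 < sigA"
    and heavy_traffic: "\<And>p. 2 \<le> p \<Longrightarrow> (\<lambda>n. rs n * (lamr n * law_mean (V p) - 1)) \<longlonglongrightarrow> \<kappa>"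
    and lamr_lim: "lamr \<longlonglongrightarrow> lam"
    and sigAr_lim: "sigAr \<longlonglongrightarrow> sigA"
    and first_mean:
      "limsup (\<lambda>n. ereal (prob_space.expectation (N n) (T n 1))) \<le> ereal (1 / lam)"
    and first_variance:
      "limsup (\<lambda>n. ereal (max (prob_space.variance (N n) (T n 1))
        (prob_space.expectation (N n) (\<lambda>\<omega>. (T n 1 \<omega> - 1 / lamr n)\<^sup>2)))) \<le> ereal (sigA\<^sup>2)"
    and arrival_clt:
      "conv_in_distribution (skorohod_topology UNIV) N
        (\<lambda>n \<omega>. \<lambda>t\<in>{0..}. (arrival_count (\<lambda>i. T n i \<omega>) ((rs n)\<^sup>2 * t) - lamr n * (rs n)\<^sup>2 * t) / rs n)
        M (\<lambda>\<omega>. \<lambda>t\<in>{0..}. sqrt (lam ^ 3 * sigA\<^sup>2) * B t \<omega>)"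
    \<comment> \<open>limit objects\<close>
    and prob_space_M: "prob_space M"
    and BM: "standard_BM M B"
    and xi_meas: "\<And>p a. 2 \<le> p \<Longrightarrow> 0 \<le> a \<Longrightarrow> xi p a \<in> borel_measurable M"
    and xi_nonneg: "\<And>p a \<omega>. 2 \<le> p \<Longrightarrow> 0 \<le> a \<Longrightarrow> \<omega> \<in> space M \<Longrightarrow> 0 \<le> xi p a \<omega>"
    and xi_cont: "\<And>p \<omega>. 2 \<le> p \<Longrightarrow> \<omega> \<in> space M \<Longrightarrow> continuous_on {0..} (\<lambda>a. xi p a \<omega>)"
    and xi_mono: "\<And>p \<omega>. 2 \<le> p \<Longrightarrow> \<omega> \<in> space M \<Longrightarrow> mono_on {0..} (\<lambda>a. xi p a \<omega>)"
    and xi_inf_lim: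
      "\<And>p \<omega>. 2 \<le> p \<Longrightarrow> \<omega> \<in> space M \<Longrightarrow> ((\<lambda>a. xi p a \<omega>) \<longlongrightarrow> xi_inf p \<omega>) at_top"
    and xi_inf_integrable: "\<And>p. 2 \<le> p \<Longrightarrow> integrable M (xi_inf p)"
    and BM_xi_indep: "\<And>p. 2 \<le> p \<Longrightarrow>
      prob_space.indep_set M
        (sets (vimage_algebra (space M) (\<lambda>\<omega>. \<lambda>t\<in>{0..}. B t \<omega>) (\<Pi>\<^sub>M t\<in>{0..}. borel)))
        (sets (vimage_algebra (space M) (\<lambda>\<omega>. (\<lambda>a\<in>{0..}. xi p a \<omega>, xi_inf p \<omega>))
          ((\<Pi>\<^sub>M a\<in>{0..}. borel) \<Otimes>\<^sub>M borel)))"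
    \<comment> \<open>initial conditions\<close>
    and init_conv: "\<And>p. 2 \<le> p \<Longrightarrow>
      conv_in_distribution (prod_topology (skorohod_topology {0..}) (top_of_set {0..})) N
        (\<lambda>n \<omega>.
          (\<lambda>a\<in>{0..}. init_work (rs n) (q p n \<omega>) (\<lambda>l. b p n l \<omega>) (ereal (a * c_fun (V p) (rs n))),
           init_work (rs n) (q p n \<omega>) (\<lambda>l. b p n l \<omega>) \<infinity>))
        M (\<lambda>\<omega>. (\<lambda>a\<in>{0..}. xi p a \<omega>, xi_inf p \<omega>))"
    and init_ui: "\<And>p. 2 \<le> p \<Longrightarrow>
      uniformly_integrable_seq N (\<lambda>n \<omega>. init_work (rs n) (q p n \<omega>) (\<lambda>l. b p n l \<omega>) \<infinity>)"
    and init_eta: "\<And>p. 2 \<le> p \<Longrightarrow> \<exists>\<eta>. admissible_eta rs N (V p) (q p) (b p) p \<eta>"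
    and init_alpha: "\<And>p. 2 \<le> p \<Longrightarrow> \<exists>\<alpha>. 0 < \<alpha> \<and> \<alpha> \<le> p \<and>
      Limsup at_top (\<lambda>a. ereal (a powr \<alpha> * (\<integral>\<omega>. xi_inf p \<omega> - xi p a \<omega> \<partial>M))) < \<infinity>"
    and init_small: "\<And>p a. 2 \<le> p \<Longrightarrow> 0 \<le> a \<Longrightarrow>
      conv_in_prob_0 N
        (\<lambda>n \<omega>. ereal (c_fun (V p) (rs n) / rs n * (\<Sum>l=1..q p n \<omega>. of_bool (b p n l \<omega> \<le> a))))
        sequentially"


section \<open>Limit processes\<close>

definition limit_sd :: "real \<Rightarrow> real \<Rightarrow> real measure \<Rightarrow> real" where
  "limit_sd lam sigA V = sqrt (lam * law_variance V + lam * sigA\<^sup>2)"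

text \<open>In the next three definitions \<open>z\<close>, \<open>z_inf\<close> and \<open>w\<close> are sample paths (values) of
  \<open>\<xi>\<close>, \<open>\<xi>(\<infinity>)\<close> and the Brownian motion, and \<open>\<sigma>\<close> is the standard deviation given by \<open>limit_sd\<close>.\<close>

definition limit_workload_trunc ::
  "real \<Rightarrow> real \<Rightarrow> real \<Rightarrow> real \<Rightarrow> (real \<Rightarrow> real) \<Rightarrow> (real \<Rightarrow> real) \<Rightarrow> real \<Rightarrow> real \<Rightarrow> real" where
  "limit_workload_trunc p \<kappa> lam \<sigma> z w x =
     skorohod_map (\<lambda>t. z x + \<sigma> * w t + (\<kappa> - lam * x powr (- p)) * t)"

definition limit_workload ::
  "real \<Rightarrow> real \<Rightarrow> real \<Rightarrow> (real \<Rightarrow> real) \<Rightarrow> real \<Rightarrow> real" where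
  "limit_workload \<kappa> \<sigma> z_inf w = skorohod_map (\<lambda>t. z_inf + \<sigma> * w t + \<kappa> * t)"

definition limit_queue ::
  "real \<Rightarrow> real \<Rightarrow> real \<Rightarrow> real \<Rightarrow> (real \<Rightarrow> real) \<Rightarrow> (real \<Rightarrow> real) \<Rightarrow> real \<Rightarrow> ennreal" where
  "limit_queue p \<kappa> lam \<sigma> z w t =
     (\<integral>\<^sup>+x\<in>{0<..}. ennreal (limit_workload_trunc p \<kappa> lam \<sigma> z w x t / x\<^sup>2) \<partial>lborel)"

definition C0 :: "'o measure \<Rightarrow> (real \<Rightarrow> 'o \<Rightarrow> real) \<Rightarrow> real \<Rightarrow> real \<Rightarrow> ennreal" where
  "C0 M z p \<eta> = 2 * (SUP a\<in>{0<..}. ennreal (a powr (- (p - \<eta>))) * (\<integral>\<^sup>+\<omega>. ennreal (z a \<omega>) \<partial>M))"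

end

(* Both Q(t) and W_inf(t) are integrals against dx/x^2, the latter of W_inf(t) over x > 1, so Q - W_inf
   is controlled by W_x for x <= 1 and by W_x - W_inf for x > 1. For x > 1 the Skorohod map is
   Lipschitz, and the inputs differ by at most xi(inf) - xi(x) + lam x^(-p) tau; here xi(x) is replaced
   by 0 for x < a and by xi(a) beyond, and a is then taken close to 1. For x <= 1 the drift
   -lam x^(-p) is strong: W_x(t) <= xi(x) + sup_u (A u^(1/8) - lam x^(-p) u), where A comes from a
   Hoelder constant of B on [0, tau], and this supremum is of order x^(p/7), whose integral against
   dx/x^2 over (0, 1] is of order 1/p. The integral of xi(x)/x^2 over (0, 1] has mean at most
   C/(p - 1 - eta(p)) by Tonelli. A bound on the Hoelder constant with high probability suffices, since
   B does not depend on p; it follows from fourth moments of the dyadic increments. *)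
theory Submission
  imports Defs "HOL-Real_Asymp.Real_Asymp"
begin

section \<open>Integrals of powers on both sides of 1\<close>

lemma nn_integral_powr_unit_interval:
  assumes "-1 < (a::real)"
  shows "(\<integral>\<^sup>+x\<in>{0<..1}. ennreal (x powr a) \<partial>lborel) = ennreal (1 / (a + 1))"
proof -
  have "((\<lambda>x. x powr a) has_integral (1 / (a + 1))) {0..1}"
    using has_integral_powr_from_0[OF assms, of 1] by simp
  then have "((\<lambda>x. if x \<in> {0..1} then x powr a else 0) has_integral (1 / (a + 1))) UNIV"
    by (subst has_integral_restrict_UNIV)
  then have "(\<integral>\<^sup>+x. ennreal (if x \<in> {0..1} then x powr a else 0) \<partial>lborel) = ennreal (1 / (a + 1))"
    by (intro nn_integral_has_integral_lborel) auto
  \<comment> \<open>\<open>0 powr a\<close> is 0, so the endpoint 0 drops out pointwise.\<close>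
  also have "(\<integral>\<^sup>+x. ennreal (if x \<in> {0..1} then x powr a else 0) \<partial>lborel) =
      (\<integral>\<^sup>+x\<in>{0<..1}. ennreal (x powr a) \<partial>lborel)"
    by (intro nn_integral_cong) (auto simp: indicator_def)
  finally show ?thesis .
qed

lemma nn_integral_powr_unit_tail:
  assumes "(a::real) < -1"
  shows "(\<integral>\<^sup>+x\<in>{1<..}. ennreal (x powr a) \<partial>lborel) = ennreal (1 / (- a - 1))"
proof -
  have "((\<lambda>x. x powr a) has_integral (1 / (- a - 1))) {1..}"
    using has_integral_powr_to_inf[OF assms, of 1] by (simp add: minus_divide_right)
  then have "((\<lambda>x. if x \<in> {1..} then x powr a else 0) has_integral (1 / (- a - 1))) UNIV"
    by (subst has_integral_restrict_UNIV)
  then have "(\<integral>\<^sup>+x. ennreal (if x \<in> {1..} then x powr a else 0) \<partial>lborel) = ennreal (1 / (- a - 1))"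
    by (intro nn_integral_has_integral_lborel) auto
  \<comment> \<open>At 1 the integrand is 1, so this endpoint drops out only almost
    everywhere.\<close>
  also have "(\<integral>\<^sup>+x. ennreal (if x \<in> {1..} then x powr a else 0) \<partial>lborel) =
      (\<integral>\<^sup>+x\<in>{1<..}. ennreal (x powr a) \<partial>lborel)"
    using AE_lborel_singleton[of "1::real"]
    by (intro nn_integral_cong_AE) (auto simp: indicator_def)
  finally show ?thesis .
qed

section \<open>The Skorohod map\<close>

text \<open>\<open>skorohod_map f t\<close> is the larger of \<open>f t\<close> and the supremum of
  \<open>f t - f s\<close> over s in [0, t]; these are the lower bounds in that description.
  Continuity keeps the set bounded below, as the infimum of an unbounded set of reals is
  unspecified.\<close>

lemma skorohod_map_ge:
  assumes "continuous_on {0..t} f" "s \<in> {0..t}"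
  shows "f t \<le> skorohod_map f t" "f t - f s \<le> skorohod_map f t"
proof -
  have "compact ((\<lambda>s. min (f s) 0) ` {0..t})"
    by (intro compact_continuous_image continuous_intros assms) auto
  then have "bdd_below ((\<lambda>s. min (f s) 0) ` {0..t})"
    by (simp add: bounded_imp_bdd_below compact_imp_bounded)
  then have "(INF s\<in>{0..t}. min (f s) 0) \<le> min (f s) 0"
    using assms(2) by (rule cINF_lower)
  then show "f t \<le> skorohod_map f t" "f t - f s \<le> skorohod_map f t"
    by (auto simp: skorohod_map_def)
qed

lemma skorohod_map_nonneg:
  assumes "continuous_on {0..t} f" "0 \<le> t"
  shows "0 \<le> skorohod_map f t"
  using skorohod_map_ge(2)[OF assms(1), of t] assms(2) by simp

text \<open>The upper bound in the same description as a maximum; \<open>0 \<le> t\<close> makes the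
  index interval nonempty.\<close>

lemma skorohod_map_le:
  assumes "0 \<le> t" "f t \<le> c" "\<And>s. s \<in> {0..t} \<Longrightarrow> f t - f s \<le> c"
  shows "skorohod_map f t \<le> c"
proof -
  have "f t - c \<le> (INF s\<in>{0..t}. min (f s) 0)"
  proof (rule cINF_greatest)
    show "f t - c \<le> min (f s) 0" if "s \<in> {0..t}" for s
      using assms(2) assms(3)[OF that] by simp
  qed (use assms(1) in auto)
  then show ?thesis
    by (simp add: skorohod_map_def)
qed

text \<open>This follows from \<open>f t - f s \<le> g t - g s + 2 * d\<close> and the description
  as a maximum. Being one-sided, it asks for continuity of \<open>g\<close> alone; exchanging the
  roles gives the two-sided estimate.\<close>

lemma skorohod_map_Lipschitz:
  assumes g: "continuous_on {0..t} g" and t: "0 \<le> t"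
    and d: "\<And>s. s \<in> {0..t} \<Longrightarrow> \<bar>f s - g s\<bar> \<le> d"
  shows "skorohod_map f t \<le> skorohod_map g t + 2 * d"
proof (rule skorohod_map_le[OF t])
  have *: "\<bar>f t - g t\<bar> \<le> d" using d[of t] t by simp
  show "f t \<le> skorohod_map g t + 2 * d"
    using skorohod_map_ge(1)[OF g, of t] t * by simp
  show "f t - f s \<le> skorohod_map g t + 2 * d" if "s \<in> {0..t}" for s
    using skorohod_map_ge(2)[OF g that] d[OF that] * by simp
qed

section \<open>Two analytic comparison estimates\<close>

text \<open>Where the difference is positive, \<open>u powr (1 - \<gamma>)\<close> is below
  \<open>A / m\<close>, which bounds \<open>u powr \<gamma>\<close>. The sublinear term will be a
  Hoelder bound for the driving path and \<open>m\<close> the strength of the negative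
  drift.\<close>

lemma sublinear_minus_linear_le:
  assumes "0 < \<gamma>" "\<gamma> < 1" "0 \<le> A" "0 < m" "0 \<le> (u::real)"
  shows "A * u powr \<gamma> - m * u \<le> A * (A / m) powr (\<gamma> / (1 - \<gamma>))"
proof (cases "A * u powr \<gamma> \<le> m * u")
  case True
  then show ?thesis using assms by (smt (verit) mult_nonneg_nonneg powr_ge_zero)
next
  case False
  then have u: "0 < u" using assms by (cases "u = 0") auto
  have "m * u powr (1 - \<gamma>) < A"
  proof -
    have "m * u powr (1 - \<gamma>) * u powr \<gamma> = m * u"
      using u by (simp add: mult.assoc flip: powr_add)
    then show ?thesis using False u by (smt (verit) mult_right_mono powr_ge_zero)
  qed
  then have "u powr (1 - \<gamma>) \<le> A / m" using assms by (simp add: field_simps)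
  then have "(u powr (1 - \<gamma>)) powr (\<gamma> / (1 - \<gamma>)) \<le> (A / m) powr (\<gamma> / (1 - \<gamma>))"
    using assms by (intro powr_mono2) auto
  also have "(u powr (1 - \<gamma>)) powr (\<gamma> / (1 - \<gamma>)) = u powr \<gamma>"
    using assms by (simp add: powr_powr)
  finally have "A * u powr \<gamma> \<le> A * (A / m) powr (\<gamma> / (1 - \<gamma>))"
    using assms by (intro mult_left_mono) auto
  then show ?thesis using assms by (smt (verit) mult_nonneg_nonneg)
qed

text \<open>As the integral of \<open>1 / x\<^sup>2\<close> over \<open>x > 1\<close> is 1, the constant \<open>c\<close> is itself an
  integral against \<open>1 / x\<^sup>2\<close>.\<close>

lemma nn_integral_inverse_square_compare:
  fixes f d :: "real \<Rightarrow> real"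
  assumes d[measurable]: "d \<in> borel_measurable borel" and d0: "\<And>x. 0 < x \<Longrightarrow> 0 \<le> d x" and c: "0 \<le> c"
    and up: "\<And>x. 0 < x \<Longrightarrow> f x \<le> c * indicator {1<..} x + d x"
    and low: "\<And>x. 1 < x \<Longrightarrow> c \<le> f x + d x"
  defines "I \<equiv> \<lambda>g. \<integral>\<^sup>+x\<in>{0<..}. ennreal (g x / x\<^sup>2) \<partial>lborel"
  shows "\<bar>enn2ereal (I f) - ereal c\<bar> \<le> enn2ereal (I d)"
proof -
  define h where "h = (\<lambda>x::real. c * indicator {1<..} x)"
  have [measurable]: "h \<in> borel_measurable borel" unfolding h_def by measurable
  have "I h = (\<integral>\<^sup>+x. ennreal c * (ennreal (x powr -2) * indicator {1<..} x) \<partial>lborel)"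
    unfolding I_def h_def
    by (intro nn_integral_cong)
       (use c in \<open>auto simp: indicator_def powr_minus_divide simp flip: ennreal_mult\<close>)
  also have "\<dots> = ennreal c"
    using nn_integral_powr_unit_tail[of "-2"] by (subst nn_integral_cmult) auto
  finally have Ih: "I h = ennreal c" .
  have add: "I (\<lambda>x. g x + g' x) = I g + I g'"
    if [measurable]: "g \<in> borel_measurable borel" "g' \<in> borel_measurable borel"
      and "\<And>x. 0 < x \<Longrightarrow> 0 \<le> g x" "\<And>x. 0 < x \<Longrightarrow> 0 \<le> g' x" for g g' :: "real \<Rightarrow> real"
  proof -
    have "I (\<lambda>x. g x + g' x) = (\<integral>\<^sup>+x. ennreal (g x / x\<^sup>2) * indicator {0<..} x
        + ennreal (g' x / x\<^sup>2) * indicator {0<..} x \<partial>lborel)"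
      unfolding I_def using that(3,4)
      by (intro nn_integral_cong) (auto simp: indicator_def add_divide_distrib ennreal_plus)
    also have "\<dots> = I g + I g'"
      unfolding I_def by (subst nn_integral_add) auto
    finally show ?thesis .
  qed
  have mono: "I g \<le> I g'" if "\<And>x. 0 < x \<Longrightarrow> g x \<le> g' x" for g g' :: "real \<Rightarrow> real"
    unfolding I_def using that
    by (intro nn_integral_mono) (auto simp: indicator_def intro!: ennreal_leI divide_right_mono)
  have h0: "0 \<le> h x" for x using c by (simp add: h_def)
  have "I f \<le> I (\<lambda>x. h x + d x)" by (rule mono) (use up in \<open>auto simp: h_def\<close>)
  also have "\<dots> = ennreal c + I d" using h0 d0 by (subst add) (auto simp: Ih)
  finally have upper: "I f \<le> ennreal c + I d" .
  \<comment> \<open>The truncated difference replaces \<open>f\<close>, which may not be measurable.\<close>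
  have "ennreal c \<le> I (\<lambda>x. max 0 (h x - d x) + d x)"
    unfolding Ih[symmetric] by (rule mono) auto
  also have "\<dots> = I (\<lambda>x. max 0 (h x - d x)) + I d" using d0 by (subst add) auto
  also have "I (\<lambda>x. max 0 (h x - d x)) \<le> I f"
    unfolding I_def
  proof (intro nn_integral_mono)
    fix x :: real
    \<comment> \<open>\<open>h\<close> vanishes on (0, 1], so \<open>h x - d x\<close> can be
      positive only for x > 1, where \<open>low\<close> applies.\<close>
    have "ennreal (max 0 (h x - d x) / x\<^sup>2) \<le> ennreal (f x / x\<^sup>2)" if "0 < x"
    proof (cases "h x - d x \<le> 0")
      case False
      then have "1 < x" using d0[OF that] by (cases "1 < x") (auto simp: h_def)
      then show ?thesis using low[of x] False
        by (intro ennreal_leI divide_right_mono) (auto simp: h_def)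
    qed (simp add: max_def)
    then show "ennreal (max 0 (h x - d x) / x\<^sup>2) * indicator {0<..} x
        \<le> ennreal (f x / x\<^sup>2) * indicator {0<..} x"
      by (auto simp: indicator_def)
  qed
  finally have lower: "ennreal c \<le> I f + I d" by (simp add: add_right_mono)
  show ?thesis
  \<comment> \<open>If \<open>I d\<close> is finite, the upper estimate makes \<open>I f\<close>
    finite too and everything reduces to real arithmetic; otherwise the right-hand side is
    infinite.\<close>
  proof (cases "I d = \<infinity>")
    case False
    then obtain D where D: "I d = ennreal D" "0 \<le> D" by (cases "I d") auto
    moreover from upper D c obtain F where F: "I f = ennreal F" "0 \<le> F"
      by (cases "I f") (auto simp: top_unique simp flip: ennreal_plus)
    ultimately show ?thesis
      using upper lower c by (auto simp: enn2ereal_ennreal abs_le_iff simp flip: ennreal_plus)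
  qed simp
qed

section \<open>Hoelder continuity from dyadic increments\<close>

text \<open>Chaining: each of s and t is approximated by the dyadic points below it, and passing
  from level n to the point itself costs a geometric series with ratio \<open>\<theta>\<close>. At
  level n the two dyadic points are equal or adjacent. These three contributions give the factor
  3.\<close>

lemma dyadic_Hoelder:
  fixes f :: "real \<Rightarrow> real"
  assumes cont: "continuous_on {0..1} f" and th: "0 < \<theta>" "\<theta> < 1" and C: "0 \<le> C"
    and incr: "\<And>n k. k < 2 ^ n \<Longrightarrow> \<bar>f (real (Suc k) / 2 ^ n) - f (real k / 2 ^ n)\<bar> \<le> C * \<theta> ^ n"
    and st: "0 \<le> s" "s \<le> t" "t \<le> 1" "t - s \<le> 1 / 2 ^ n"
  shows "\<bar>f t - f s\<bar> \<le> 3 * C / (1 - \<theta>) * \<theta> ^ n"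
proof -
  define k where "k = (\<lambda>m (x::real). nat \<lfloor>2 ^ m * x\<rfloor>)"
  define r where "r = (\<lambda>m (x::real). real (k m x) / 2 ^ m)"
  have k: "real (k m x) \<le> 2 ^ m * x" "2 ^ m * x < real (k m x) + 1" if "0 \<le> x" for m x
    using that by (auto simp: k_def)
  have kle: "k m x \<le> 2 ^ m" if "0 \<le> x" "x \<le> 1" for m x
  proof -
    have "2 ^ m * x \<le> 2 ^ m" using that by (simp add: mult_left_le)
    then have "real (k m x) \<le> 2 ^ m" using k(1)[OF that(1), of m] by linarith
    then show ?thesis by simp
  qed
  have step: "\<bar>f (real j / 2 ^ m) - f (real i / 2 ^ m)\<bar> \<le> C * \<theta> ^ m"
    if "i \<le> j" "j \<le> Suc i" "j \<le> 2 ^ m" for i j m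
    using that incr[of i m] C th by (cases "j = i") (auto simp: le_Suc_eq)
  have lim: "(\<lambda>m. f (r m x)) \<longlonglongrightarrow> f x" if x: "0 \<le> x" "x \<le> 1" for x
  proof -
    have "(\<lambda>m. r m x) \<longlonglongrightarrow> x"
    proof (rule tendsto_sandwich)
      show "\<forall>\<^sub>F m in sequentially. x - (1/2) ^ m \<le> r m x"
      proof (intro always_eventually allI)
        fix m
        have "(2 ^ m * x - 1) / 2 ^ m \<le> r m x"
          unfolding r_def using k(2)[OF x(1), of m] by (intro divide_right_mono) auto
        then show "x - (1/2) ^ m \<le> r m x" by (simp add: diff_divide_distrib power_one_over)
      qed
      show "\<forall>\<^sub>F m in sequentially. r m x \<le> x"
        using k(1)[OF x(1)] by (intro always_eventually) (auto simp: r_def field_simps)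
      show "(\<lambda>m. x - (1/2) ^ m) \<longlonglongrightarrow> x"
        by (rule tendsto_eq_intros LIMSEQ_power_zero refl | simp)+
    qed simp
    moreover have "r m x \<in> {0..1}" for m
    proof -
      have "real (k m x) \<le> 2 ^ m" using kle[OF x, of m] by simp
      then show ?thesis by (simp add: r_def)
    qed
    ultimately show ?thesis
      using continuous_on_tendsto_compose[OF cont, of "\<lambda>m. r m x" x sequentially] x by auto
  qed
  have tail: "\<bar>f x - f (r n x)\<bar> \<le> C * \<theta> ^ n / (1 - \<theta>)" if x: "0 \<le> x" "x \<le> 1" for x
  proof -
    \<comment> \<open>Halving a dyadic cell moves its left endpoint by at most one cell of the finer
      level.\<close>
    have one: "\<bar>f (r (Suc m) x) - f (r m x)\<bar> \<le> C * \<theta> ^ Suc m" for m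
    proof -
      have "r m x = real (2 * k m x) / 2 ^ Suc m" by (simp add: r_def)
      moreover have "2 * k m x \<le> k (Suc m) x" "k (Suc m) x \<le> Suc (2 * k m x)"
        using k[OF x(1), of m] k[OF x(1), of "Suc m"] by auto
      ultimately show ?thesis
        using step[OF _ _ kle[OF x], of "2 * k m x" "Suc m"] by (simp add: r_def)
    qed
    \<comment> \<open>The factor with \<open>1 - \<theta> ^ j\<close> is the closed form of the sum
      of \<open>C * \<theta> ^ (n + i)\<close> over i < j; each step costs even one power of
      \<open>\<theta>\<close> less than allowed.\<close>
    have "\<bar>f (r (n + j) x) - f (r n x)\<bar> \<le> C * \<theta> ^ n / (1 - \<theta>) * (1 - \<theta> ^ j)" for j
    proof (induction j)
      case (Suc j)
      have "C * \<theta> ^ Suc (n + j) \<le> C * \<theta> ^ (n + j)"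
        using th C by (intro mult_left_mono) auto
      then have "\<bar>f (r (n + Suc j) x) - f (r n x)\<bar>
          \<le> C * \<theta> ^ n / (1 - \<theta>) * (1 - \<theta> ^ j) + C * \<theta> ^ (n + j)"
        using Suc one[of "n + j"] by auto
      also have "\<dots> = C * \<theta> ^ n / (1 - \<theta>) * (1 - \<theta> ^ Suc j)"
        using th by (simp add: power_add divide_simps) (simp add: algebra_simps)
      finally show ?case .
    qed simp
    also have "\<dots> j \<le> C * \<theta> ^ n / (1 - \<theta>)" for j
      using th C by (intro mult_left_le) auto
    finally have "\<bar>f (r (n + j) x) - f (r n x)\<bar> \<le> C * \<theta> ^ n / (1 - \<theta>)" for j .
    moreover have "(\<lambda>j. f (r (n + j) x)) \<longlonglongrightarrow> f x"
      using LIMSEQ_ignore_initial_segment[OF lim[OF x], of n] by (simp add: add.commute)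
    ultimately show ?thesis
      by (intro tendsto_upperbound[OF tendsto_rabs[OF tendsto_diff[OF _ tendsto_const]]]) auto
  qed
  have "\<bar>f (r n t) - f (r n s)\<bar> \<le> C * \<theta> ^ n"
    unfolding r_def
  proof (rule step)
    have "2 ^ n * s \<le> 2 ^ n * t" using st by simp
    then show "k n s \<le> k n t" unfolding k_def by (intro nat_mono floor_mono)
    have "2 ^ n * t \<le> 2 ^ n * s + 1" using st(4) by (simp add: field_simps)
    then show "k n t \<le> Suc (k n s)"
      using k(1)[of t n] k(2)[of s n] st by linarith
  qed (use kle st in auto)
  also have "C * \<theta> ^ n \<le> C * \<theta> ^ n / (1 - \<theta>)"
    using th C by (simp add: field_simps)
  finally show ?thesis
    using tail[of t] tail[of s] st by simp
qed

text \<open>With \<open>\<theta> = 2 powr - \<gamma>\<close> and the level n for which t - s lies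
  between \<open>2 powr - (n + 1)\<close> and \<open>2 powr - n\<close>, the factor
  \<open>\<theta> ^ n\<close> is at most
  \<open>2 powr \<gamma> * (t - s) powr \<gamma>\<close>.\<close>

lemma dyadic_Hoelder_powr:
  fixes f :: "real \<Rightarrow> real"
  assumes cont: "continuous_on {0..1} f" and g: "0 < \<gamma>" and C: "0 \<le> C"
    and incr: "\<And>n k. k < 2 ^ n \<Longrightarrow>
      \<bar>f (real (Suc k) / 2 ^ n) - f (real k / 2 ^ n)\<bar> \<le> C * (2 powr - \<gamma>) ^ n"
    and st: "0 \<le> s" "s \<le> t" "t \<le> 1"
  shows "\<bar>f t - f s\<bar> \<le> 3 * C * 2 powr \<gamma> / (1 - 2 powr - \<gamma>) * (t - s) powr \<gamma>"
proof (cases "s = t")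
  case False
  then have u: "0 < t - s" "t - s \<le> 1" using st by auto
  define n where "n = nat \<lfloor>- log 2 (t - s)\<rfloor>"
  have "log 2 (t - s) \<le> 0" using u by simp
  then have n: "real n \<le> - log 2 (t - s)" "- log 2 (t - s) < real n + 1"
    by (auto simp: n_def)
  have "t - s = 2 powr log 2 (t - s)" using u by simp
  also have "\<dots> \<le> 2 powr - real n" using n by (intro powr_mono) auto
  finally have "t - s \<le> 1 / 2 ^ n" by (simp add: powr_minus_divide powr_realpow)
  then have "\<bar>f t - f s\<bar> \<le> 3 * C / (1 - 2 powr - \<gamma>) * (2 powr - \<gamma>) ^ n"
    using g by (intro dyadic_Hoelder[OF cont _ _ C incr st]) (auto simp: powr_less_one)
  also have "(2 powr - \<gamma>) ^ n \<le> 2 powr \<gamma> * (t - s) powr \<gamma>"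
  proof -
    have "(2 powr - \<gamma>) ^ n = 2 powr (\<gamma> * - real n)" by (simp add: powr_powr flip: powr_realpow)
    also have "\<dots> \<le> 2 powr (\<gamma> * (1 + log 2 (t - s)))"
      using n g by (intro powr_mono mult_left_mono) auto
    also have "\<dots> = 2 powr \<gamma> * (2 powr log 2 (t - s)) powr \<gamma>"
      by (simp add: powr_powr algebra_simps flip: powr_add)
    finally show ?thesis using u by simp
  qed
  finally show ?thesis
    using C g by (simp add: mult_left_mono powr_less_one divide_simps mult.assoc)
qed simp

section \<open>Pathwise comparison of queue length and workload\<close>

text \<open>Here \<open>z\<close>, \<open>z_inf\<close> and \<open>w\<close> are sample paths. The
  integral of \<open>z\<close> and the term with \<open>A\<close> stem from x \<le> 1, the drift
  term with \<open>lam * \<tau>\<close> and the last two terms from x > 1. A one-sided Hoelder bound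
  is the right form, because the Skorohod map at t sees the increments up to t with their sign.
  \<open>7 < p\<close> makes \<open>x powr (p / 7 - 2)\<close> integrable at 0. The bound is the
  same for all t, so it passes to the supremum.\<close>

lemma limit_queue_close_to_workload:
  fixes z w :: "real \<Rightarrow> real"
  assumes z_cont: "continuous_on {0..} z" and z_mono: "mono_on {0..} z" and z_nonneg: "\<And>x. 0 \<le> x \<Longrightarrow> 0 \<le> z x"
    and z_le: "\<And>x. 0 \<le> x \<Longrightarrow> z x \<le> z_inf"
    and w_cont: "continuous_on {0..} w" and w0: "w 0 = 0"
    and lam: "0 < lam" and p: "7 < p" and a: "1 < a" and A: "0 \<le> A"
    and Hoelder: "\<And>s t. 0 \<le> s \<Longrightarrow> s \<le> t \<Longrightarrow> t \<le> \<tau> \<Longrightarrow>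
      \<sigma> * (w t - w s) + \<kappa> * (t - s) \<le> A * (t - s) powr (1 / 8)"
    and t: "0 \<le> t" "t \<le> \<tau>"
  shows "\<bar>enn2ereal (limit_queue p \<kappa> lam \<sigma> z w t) - ereal (limit_workload \<kappa> \<sigma> z_inf w t)\<bar>
    \<le> enn2ereal (\<integral>\<^sup>+x\<in>{0<..1}. ennreal (z x / x\<^sup>2) \<partial>lborel)
      + ereal (A * (A / lam) powr (1 / 7) / (p / 7 - 1)
          + 2 * lam * \<tau> / (p + 1) + 2 * (a - 1) * z_inf + 2 * (z_inf - z a))"
proof -
  \<comment> \<open>\<open>d\<close> bounds \<open>skorohod_map (X x) t\<close> for x \<le> 1, and
    its distance from \<open>skorohod_map Y t\<close> for x > 1. As \<open>z\<close> is continuous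
    on the half-line, \<open>max 0 x\<close> extends it to the real line and makes \<open>d\<close>
    Borel.\<close>
  define d where "d = (\<lambda>x. if x \<le> 1 then z (max 0 x) + A * (A / lam) powr (1 / 7) * x powr (p / 7)
    else 2 * lam * \<tau> * x powr - p + 2 * (if x < a then z_inf else 0) + 2 * (z_inf - z a))"
  have "continuous_on UNIV (\<lambda>x. z (max 0 x))"
    by (rule continuous_on_compose2[OF z_cont]) (auto intro!: continuous_intros)
  then have z_meas[measurable]: "(\<lambda>x. z (max 0 x)) \<in> borel_measurable borel"
    by (rule borel_measurable_continuous_onI)
  have d_meas[measurable]: "d \<in> borel_measurable borel" unfolding d_def by measurable
  have zinf: "0 \<le> z_inf" using z_nonneg[of 0] z_le[of 0] by simp
  have za: "z a \<le> z_inf" using z_le a by simp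
  have \<tau>: "0 \<le> \<tau>" using t by simp
  define X where "X = (\<lambda>x t. z x + \<sigma> * w t + (\<kappa> - lam * x powr (- p)) * t)"
  define Y where "Y = (\<lambda>t. z_inf + \<sigma> * w t + \<kappa> * t)"
  have wc: "continuous_on {0..t} w" by (rule continuous_on_subset[OF w_cont]) auto
  have X_cont: "continuous_on {0..t} (X x)" for x
    unfolding X_def by (intro continuous_intros wc)
  have Y_cont: "continuous_on {0..t} Y"
    unfolding Y_def by (intro continuous_intros wc)
  have small: "skorohod_map (X x) t \<le> d x" if x: "0 < x" "x \<le> 1" for x
  proof -
    define m where "m = lam * x powr - p"
    have m: "0 < m" using lam x by (simp add: m_def)
    have inc: "X x t - X x s \<le> A * (A / lam) powr (1 / 7) * x powr (p / 7)" if s: "s \<in> {0..t}" for s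
    proof -
      have "X x t - X x s = \<sigma> * (w t - w s) + \<kappa> * (t - s) - m * (t - s)"
        by (simp add: X_def m_def algebra_simps)
      also have "\<dots> \<le> A * (t - s) powr (1 / 8) - m * (t - s)"
        using Hoelder[of s t] s t by simp
      also have "\<dots> \<le> A * (A / m) powr ((1 / 8) / (1 - 1 / 8))"
        using s by (intro sublinear_minus_linear_le A m) auto
      also have "(A / m) powr ((1 / 8) / (1 - 1 / 8)) = (A / lam * x powr p) powr (1 / 7)"
        by (simp add: m_def powr_minus divide_simps)
      also have "\<dots> = (A / lam) powr (1 / 7) * x powr (p / 7)"
        using A lam by (subst powr_mult) (auto simp: powr_powr)
      finally show ?thesis by (simp add: mult.assoc)
    qed
    \<comment> \<open>The case s = 0 of \<open>inc\<close> bounds \<open>X x t\<close> itself, the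
      other quantity that \<open>skorohod_map_le\<close> requires.\<close>
    have "X x 0 = z x" by (simp add: X_def w0)
    then have "X x t \<le> z x + A * (A / lam) powr (1 / 7) * x powr (p / 7)"
      using inc[of 0] t by simp
    moreover have "0 \<le> z x" using z_nonneg x by simp
    ultimately have "skorohod_map (X x) t \<le> z x + A * (A / lam) powr (1 / 7) * x powr (p / 7)"
      using inc by (intro skorohod_map_le t) (auto intro: order_trans add_increasing)
    then show ?thesis using x by (simp add: d_def)
  qed
  have large: "\<bar>skorohod_map (X x) t - skorohod_map Y t\<bar> \<le> d x" if x: "1 < x" for x
  proof -
    have "\<bar>X x s - Y s\<bar> \<le> z_inf - z x + lam * \<tau> * x powr - p" if s: "s \<in> {0..t}" for s
    proof -
      have "Y s - X x s = z_inf - z x + lam * x powr - p * s"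
        by (simp add: X_def Y_def algebra_simps)
      moreover have "lam * x powr - p * s \<le> lam * x powr - p * \<tau>"
        using s t lam by (intro mult_left_mono) auto
      moreover have "0 \<le> lam * x powr - p * s" using s lam by simp
      moreover have "z x \<le> z_inf" using z_le x by simp
      ultimately show ?thesis by (simp add: mult_ac)
    qed
    then have "\<bar>skorohod_map (X x) t - skorohod_map Y t\<bar> \<le> 2 * (z_inf - z x + lam * \<tau> * x powr - p)"
      using skorohod_map_Lipschitz[OF Y_cont t(1), of "X x"] skorohod_map_Lipschitz[OF X_cont t(1), of Y x]
      by (fastforce simp: abs_minus_commute abs_le_iff)
    also have "\<dots> \<le> d x"
    proof (cases "x < a")
      case True
      then show ?thesis using x za z_nonneg[of x] by (simp add: d_def)
    next
      case False
      then have "z a \<le> z x" using a by (intro mono_onD[OF z_mono]) auto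
      then show ?thesis using x False by (simp add: d_def)
    qed
    finally show ?thesis .
  qed
  have dnn: "0 \<le> d x" if "0 < x" for x
    using that z_nonneg A lam \<tau> zinf za by (auto simp: d_def)
  have queue_eq: "limit_queue p \<kappa> lam \<sigma> z w t =
      (\<integral>\<^sup>+x\<in>{0<..}. ennreal (skorohod_map (X x) t / x\<^sup>2) \<partial>lborel)"
    by (simp add: limit_queue_def limit_workload_trunc_def X_def)
  have workload_eq: "limit_workload \<kappa> \<sigma> z_inf w t = skorohod_map Y t"
    by (simp add: limit_workload_def Y_def)
  have "\<bar>enn2ereal (limit_queue p \<kappa> lam \<sigma> z w t) - ereal (limit_workload \<kappa> \<sigma> z_inf w t)\<bar>
      \<le> enn2ereal (\<integral>\<^sup>+x\<in>{0<..}. ennreal (d x / x\<^sup>2) \<partial>lborel)"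
    unfolding queue_eq workload_eq
  proof (rule nn_integral_inverse_square_compare)
    show "0 \<le> skorohod_map Y t" by (rule skorohod_map_nonneg[OF Y_cont t(1)])
    show "skorohod_map (X x) t \<le> skorohod_map Y t * indicator {1<..} x + d x" if "0 < x" for x
      using small[of x] large[of x] that by (cases "1 < x") auto
    show "skorohod_map Y t \<le> skorohod_map (X x) t + d x" if "1 < x" for x
      using large[OF that] by simp
  qed (use dnn in auto)
  \<comment> \<open>On (1, a) the factor 1 / x^2 is estimated by 1, so that this part contributes at
    most the length a - 1 times \<open>2 * z_inf\<close>.\<close>
  also have "(\<integral>\<^sup>+x\<in>{0<..}. ennreal (d x / x\<^sup>2) \<partial>lborel) \<le>
      (\<integral>\<^sup>+x. ennreal (z (max 0 x) / x\<^sup>2) * indicator {0<..1} x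
        + ennreal (A * (A / lam) powr (1 / 7)) * (ennreal (x powr (p / 7 - 2)) * indicator {0<..1} x)
        + ennreal (2 * lam * \<tau>) * (ennreal (x powr (- p - 2)) * indicator {1<..} x)
        + ennreal (2 * z_inf) * indicator {1<..<a} x
        + ennreal (2 * (z_inf - z a)) * (ennreal (x powr - 2) * indicator {1<..} x) \<partial>lborel)"
  proof (rule nn_integral_mono)
    fix x :: real
    consider "x \<le> 0" | "0 < x" "x \<le> 1" | "1 < x" by linarith
    then show "ennreal (d x / x\<^sup>2) * indicator {0<..} x \<le>
        ennreal (z (max 0 x) / x\<^sup>2) * indicator {0<..1} x
        + ennreal (A * (A / lam) powr (1 / 7)) * (ennreal (x powr (p / 7 - 2)) * indicator {0<..1} x)
        + ennreal (2 * lam * \<tau>) * (ennreal (x powr (- p - 2)) * indicator {1<..} x)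
        + ennreal (2 * z_inf) * indicator {1<..<a} x
        + ennreal (2 * (z_inf - z a)) * (ennreal (x powr - 2) * indicator {1<..} x)"
    proof cases
      case 2
      have "d x / x\<^sup>2 = z x / x\<^sup>2 + A * (A / lam) powr (1 / 7) * x powr (p / 7 - 2)"
        using 2 by (simp add: d_def powr_diff add_divide_distrib)
      then show ?thesis
        using 2 z_nonneg[of x] A by (simp flip: ennreal_plus ennreal_mult)
    next
      case 3
      have "1 \<le> x\<^sup>2" using 3 by simp
      then have "(if x < a then z_inf else 0) / x\<^sup>2 \<le> (if x < a then z_inf else 0)"
        using zinf by (simp add: divide_le_eq mult_le_cancel_left1)
      moreover have "d x / x\<^sup>2 = 2 * lam * \<tau> * x powr (- p - 2)
          + 2 * ((if x < a then z_inf else 0) / x\<^sup>2) + 2 * (z_inf - z a) * x powr - 2"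
        using 3 by (simp add: d_def powr_diff powr_minus_divide add_divide_distrib)
      ultimately have "ennreal (d x / x\<^sup>2) \<le> ennreal (2 * lam * \<tau> * x powr (- p - 2)
          + (if x < a then 2 * z_inf else 0) + 2 * (z_inf - z a) * x powr - 2)"
        by (intro ennreal_leI) (auto split: if_splits)
      also have "\<dots> = ennreal (2 * lam * \<tau>) * ennreal (x powr (- p - 2))
          + (if x < a then ennreal (2 * z_inf) else 0) + ennreal (2 * (z_inf - z a)) * ennreal (x powr - 2)"
        using lam \<tau> zinf za by (auto simp flip: ennreal_plus ennreal_mult)
      finally show ?thesis using 3 by (auto simp: indicator_def)
    qed auto
  qed
  also have "\<dots> = (\<integral>\<^sup>+x\<in>{0<..1}. ennreal (z (max 0 x) / x\<^sup>2) \<partial>lborel)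
      + ennreal (A * (A / lam) powr (1 / 7)) * (\<integral>\<^sup>+x\<in>{0<..1}. ennreal (x powr (p / 7 - 2)) \<partial>lborel)
      + ennreal (2 * lam * \<tau>) * (\<integral>\<^sup>+x\<in>{1<..}. ennreal (x powr (- p - 2)) \<partial>lborel)
      + ennreal (2 * z_inf) * emeasure lborel {1<..<a}
      + ennreal (2 * (z_inf - z a)) * (\<integral>\<^sup>+x\<in>{1<..}. ennreal (x powr - 2) \<partial>lborel)"
    by (simp add: nn_integral_add nn_integral_cmult)
  also have "\<dots> = (\<integral>\<^sup>+x\<in>{0<..1}. ennreal (z (max 0 x) / x\<^sup>2) \<partial>lborel)
      + ennreal (A * (A / lam) powr (1 / 7)) * ennreal (1 / (p / 7 - 1))
      + ennreal (2 * lam * \<tau>) * ennreal (1 / (p + 1))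
      + ennreal (2 * z_inf) * ennreal (a - 1) + ennreal (2 * (z_inf - z a)) * ennreal 1"
    using p a nn_integral_powr_unit_interval[of "p / 7 - 2"] nn_integral_powr_unit_tail[of "- p - 2"]
      nn_integral_powr_unit_tail[of "- 2"] by (simp add: add.commute[of p 1])
  also have "\<dots> = (\<integral>\<^sup>+x\<in>{0<..1}. ennreal (z (max 0 x) / x\<^sup>2) \<partial>lborel)
      + ennreal (A * (A / lam) powr (1 / 7) / (p / 7 - 1)
          + 2 * lam * \<tau> / (p + 1) + 2 * (a - 1) * z_inf + 2 * (z_inf - z a))"
    using p a A lam \<tau> zinf za
    by (simp add: add.assoc mult_ac flip: ennreal_plus ennreal_mult)
  also have "(\<integral>\<^sup>+x\<in>{0<..1}. ennreal (z (max 0 x) / x\<^sup>2) \<partial>lborel)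
      = (\<integral>\<^sup>+x\<in>{0<..1}. ennreal (z x / x\<^sup>2) \<partial>lborel)"
    by (intro nn_integral_cong) (auto simp: indicator_def)
  finally show ?thesis
    using p a A lam \<tau> zinf za by (simp add: less_eq_ennreal.rep_eq plus_ennreal.rep_eq enn2ereal_ennreal)
qed

section \<open>Dyadic increments of Brownian motion\<close>

text \<open>Second moments would be too weak for the chaining: on [0, \<tau>] the squares of the 2^n
  increments at level n have total mean \<tau>, whereas their fourth powers have total mean of order
  2^(-n).\<close>

lemma BM_increment_fourth_moment:
  assumes BM: "standard_BM M B" and st: "0 \<le> s" "s < t"
  shows "(\<integral>\<^sup>+\<omega>. ennreal ((B t \<omega> - B s \<omega>) ^ 4) \<partial>M) = ennreal (3 * (t - s)\<^sup>2)"
proof -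
  let ?d = "normal_density 0 (sqrt (t - s))"
  have D: "distributed M lborel (\<lambda>\<omega>. B t \<omega> - B s \<omega>) ?d"
    using BM st by (auto simp: standard_BM_def)
  \<comment> \<open>The constant (2k)! / (2^k k!) equals 3 for k = 2.\<close>
  have "has_bochner_integral lborel (\<lambda>x. ?d x * x ^ 4) (3 * (t - s)\<^sup>2)"
    using normal_moment_even[of "sqrt (t - s)" 0 2] st
    by (simp add: fact_numeral power_divide power2_eq_square)
  then have "(\<integral>\<^sup>+x. ennreal (?d x * x ^ 4) \<partial>lborel) = ennreal (3 * (t - s)\<^sup>2)"
    by (subst nn_integral_eq_integral) (auto simp: has_bochner_integral_iff)
  also have "(\<integral>\<^sup>+x. ennreal (?d x * x ^ 4) \<partial>lborel) = (\<integral>\<^sup>+x. ennreal (?d x) * ennreal (x ^ 4) \<partial>lborel)"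
    by (intro nn_integral_cong) (simp add: ennreal_mult)
  also have "\<dots> = (\<integral>\<^sup>+\<omega>. ennreal ((B t \<omega> - B s \<omega>) ^ 4) \<partial>M)"
    by (rule distributed_nn_integral[OF D]) simp
  finally show ?thesis .
qed

lemma BM_increment_measurable:
  assumes "standard_BM M B" "0 \<le> s" "s < t"
  shows "(\<lambda>\<omega>. B t \<omega> - B s \<omega>) \<in> borel_measurable M"
proof -
  have "distributed M lborel (\<lambda>\<omega>. B t \<omega> - B s \<omega>) (normal_density 0 (sqrt (t - s)))"
    using assms by (auto simp: standard_BM_def)
  from distributed_measurable[OF this] show ?thesis by simp
qed

text \<open>A bound on this weighted sum of fourth powers bounds every increment at level \<open>n\<close> by a multiple
  of \<open>\<theta>\<^sup>n\<close>; for Brownian motion its mean is a geometric series with ratio \<open>1 / (2 * \<theta> ^ 4)\<close>.\<close>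

definition dyadic_variation :: "real \<Rightarrow> real \<Rightarrow> (real \<Rightarrow> real) \<Rightarrow> ennreal" where
  "dyadic_variation \<theta> \<tau> w = (\<Sum>n. \<Sum>k<2 ^ n.
     ennreal ((1 / \<theta> ^ 4) ^ n) * ennreal ((w (\<tau> * (real (Suc k) / 2 ^ n)) - w (\<tau> * (real k / 2 ^ n))) ^ 4))"

text \<open>A single summand is at most the whole nonnegative sum; taking the fourth root turns the
  weight into \<open>\<theta> ^ n\<close>.\<close>

lemma dyadic_increment_le:
  assumes Z: "dyadic_variation \<theta> \<tau> w \<le> ennreal (C ^ 4)" and C: "0 \<le> C" and th: "0 < \<theta>" and k: "k < 2 ^ n"
  shows "\<bar>w (\<tau> * (real (Suc k) / 2 ^ n)) - w (\<tau> * (real k / 2 ^ n))\<bar> \<le> C * \<theta> ^ n"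
proof -
  let ?x = "\<lambda>n k. w (\<tau> * (real (Suc k) / 2 ^ n)) - w (\<tau> * (real k / 2 ^ n))"
  let ?g = "\<lambda>n k. ennreal ((1 / \<theta> ^ 4) ^ n) * ennreal (?x n k ^ 4)"
  have "?g n k \<le> (\<Sum>k<2 ^ n. ?g n k)"
    using k by (intro member_le_sum) auto
  also have "\<dots> = (\<Sum>m\<in>{n}. \<Sum>k<2 ^ m. ?g m k)" by simp
  also have "\<dots> \<le> dyadic_variation \<theta> \<tau> w"
    unfolding dyadic_variation_def by (rule sum_le_suminf) auto
  also note Z
  finally have "ennreal ((1 / \<theta> ^ 4) ^ n * ?x n k ^ 4) \<le> ennreal (C ^ 4)"
    using th by (subst ennreal_mult) auto
  then have "(1 / \<theta> ^ 4) ^ n * ?x n k ^ 4 \<le> C ^ 4"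
    by (subst (asm) ennreal_le_iff) (use C in auto)
  then have "?x n k ^ 4 \<le> C ^ 4 * (\<theta> ^ 4) ^ n"
    using th by (simp add: power_divide divide_simps mult_ac)
  also have "\<dots> = (C * \<theta> ^ n) ^ 4"
    by (simp add: power_mult_distrib mult.commute flip: power_mult)
  finally have "\<bar>?x n k\<bar> ^ 4 \<le> (C * \<theta> ^ n) ^ 4" by simp
  then show ?thesis
    using C th by (subst (asm) power_mono_iff) auto
qed

text \<open>Nonnegativity lets sum and integral be exchanged. Level n contributes 2^n increments,
  each with fourth moment \<open>3 * \<tau>\<^sup>2 * (1 / 4) ^ n\<close>, and
  \<open>1 < 2 * \<theta> ^ 4\<close> makes the weighted series converge.\<close>

lemma BM_dyadic_variation_finite_mean:
  assumes BM: "standard_BM M B" and \<tau>: "0 < \<tau>" and th: "0 < \<theta>" "1 < 2 * \<theta> ^ 4"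
  shows "(\<lambda>\<omega>. dyadic_variation \<theta> \<tau> (\<lambda>t. B t \<omega>)) \<in> borel_measurable M"
    and "(\<integral>\<^sup>+\<omega>. dyadic_variation \<theta> \<tau> (\<lambda>t. B t \<omega>) \<partial>M) < \<infinity>"
proof -
  let ?x = "\<lambda>n k \<omega>. B (\<tau> * (real (Suc k) / 2 ^ n)) \<omega> - B (\<tau> * (real k / 2 ^ n)) \<omega>"
  have lt: "0 \<le> \<tau> * (real k / 2 ^ n)" "\<tau> * (real k / 2 ^ n) < \<tau> * (real (Suc k) / 2 ^ n)" for n k
    using \<tau> by (auto simp: divide_strict_right_mono)
  have meas[measurable]: "?x n k \<in> borel_measurable M" for n k
    by (rule BM_increment_measurable[OF BM lt])
  show "(\<lambda>\<omega>. dyadic_variation \<theta> \<tau> (\<lambda>t. B t \<omega>)) \<in> borel_measurable M"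
    unfolding dyadic_variation_def by measurable
  have mom: "(\<integral>\<^sup>+\<omega>. ennreal (?x n k \<omega> ^ 4) \<partial>M) = ennreal (3 * \<tau>\<^sup>2 * (1 / 4) ^ n)" for n k
  proof -
    have "\<tau> * (real (Suc k) / 2 ^ n) - \<tau> * (real k / 2 ^ n) = \<tau> * (1 / 2) ^ n"
      by (simp add: field_simps power_divide)
    then have "3 * (\<tau> * (real (Suc k) / 2 ^ n) - \<tau> * (real k / 2 ^ n))\<^sup>2 = 3 * \<tau>\<^sup>2 * (((1/2)\<^sup>2) ^ n)"
      by (simp only: power_mult_distrib power_mult[symmetric] mult.commute[of n] mult.assoc)
    then show ?thesis
      using BM_increment_fourth_moment[OF BM lt, of k n] by (simp add: power2_eq_square mult.assoc)
  qed
  have "(\<integral>\<^sup>+\<omega>. dyadic_variation \<theta> \<tau> (\<lambda>t. B t \<omega>) \<partial>M) =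
      (\<Sum>n. \<Sum>k<2 ^ n. ennreal ((1 / \<theta> ^ 4) ^ n) * (\<integral>\<^sup>+\<omega>. ennreal (?x n k \<omega> ^ 4) \<partial>M))"
    unfolding dyadic_variation_def
    by (subst nn_integral_suminf, measurable, intro suminf_cong, subst nn_integral_sum, measurable,
        intro sum.cong refl nn_integral_cmult, measurable)
  also have "\<dots> = (\<Sum>n. ennreal (3 * \<tau>\<^sup>2 * (1 / (2 * \<theta> ^ 4)) ^ n))"
  proof (rule suminf_cong)
    fix n
    have "(\<Sum>k<(2::nat) ^ n. ennreal ((1 / \<theta> ^ 4) ^ n) * (\<integral>\<^sup>+\<omega>. ennreal (?x n k \<omega> ^ 4) \<partial>M))
        = (\<Sum>k<(2::nat) ^ n. ennreal ((1 / \<theta> ^ 4) ^ n * (3 * \<tau>\<^sup>2 * (1 / 4) ^ n)))"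
      using th unfolding mom by (intro sum.cong refl ennreal_mult[symmetric]) auto
    also have "\<dots> = ennreal (\<Sum>k<(2::nat) ^ n. (1 / \<theta> ^ 4) ^ n * (3 * \<tau>\<^sup>2 * (1 / 4) ^ n))"
      using th by (intro sum_ennreal) auto
    also have "(\<Sum>k<(2::nat) ^ n. (1 / \<theta> ^ 4) ^ n * (3 * \<tau>\<^sup>2 * (1 / 4) ^ n))
        = 3 * \<tau>\<^sup>2 * (2 ^ n * (1 / \<theta> ^ 4) ^ n * (1 / 4) ^ n)"
      by simp
    also have "2 ^ n * (1 / \<theta> ^ 4) ^ n * (1 / 4) ^ n = (1 / (2 * \<theta> ^ 4)) ^ n"
      unfolding power_mult_distrib[symmetric] by simp
    finally show "(\<Sum>k<(2::nat) ^ n. ennreal ((1 / \<theta> ^ 4) ^ n) * (\<integral>\<^sup>+\<omega>. ennreal (?x n k \<omega> ^ 4) \<partial>M))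
        = ennreal (3 * \<tau>\<^sup>2 * (1 / (2 * \<theta> ^ 4)) ^ n)" .
  qed
  also have "\<dots> = ennreal (\<Sum>n. 3 * \<tau>\<^sup>2 * (1 / (2 * \<theta> ^ 4)) ^ n)"
    using th by (intro suminf_ennreal2 summable_mult summable_geometric) auto
  also have "\<dots> < \<infinity>" by simp
  finally show "(\<integral>\<^sup>+\<omega>. dyadic_variation \<theta> \<tau> (\<lambda>t. B t \<omega>) \<partial>M) < \<infinity>" .
qed

section \<open>Mean contribution of small initial jobs\<close>

text \<open>Tonelli's theorem reduces the mean to the integral of
  \<open>C * x powr (\<beta> - 2)\<close> over (0, 1], finite since \<open>1 < \<beta>\<close>. It
  requires joint measurability, which follows from measurability for each x and continuity in
  x.\<close>

lemma nn_integral_small_sizes: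
  fixes z :: "real \<Rightarrow> 'o \<Rightarrow> real"
  assumes M: "prob_space M"
    and meas: "\<And>x. 0 \<le> x \<Longrightarrow> z x \<in> borel_measurable M"
    and cont: "\<And>\<omega>. \<omega> \<in> space M \<Longrightarrow> continuous_on {0..} (\<lambda>x. z x \<omega>)"
    and bound: "\<And>x. 0 < x \<Longrightarrow> (\<integral>\<^sup>+\<omega>. ennreal (z x \<omega>) \<partial>M) \<le> ennreal (C * x powr \<beta>)"
    and C: "0 \<le> C" and \<beta>: "1 < \<beta>"
  shows "(\<lambda>\<omega>. \<integral>\<^sup>+x\<in>{0<..1}. ennreal (z x \<omega> / x\<^sup>2) \<partial>lborel) \<in> borel_measurable M"
    and "(\<integral>\<^sup>+\<omega>. (\<integral>\<^sup>+x\<in>{0<..1}. ennreal (z x \<omega> / x\<^sup>2) \<partial>lborel) \<partial>M) \<le> ennreal (C / (\<beta> - 1))"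
proof -
  interpret prob_space M by (rule M)
  interpret pair_sigma_finite lborel M ..
  \<comment> \<open>Rounding x up to a multiple of 1 / (n + 1) gives functions that are measurable
    because the rounded argument takes countably many values. \<open>nat\<close> sends negative
    arguments to 0, so the limit is at \<open>max 0 x\<close>.\<close>
  have joint: "(\<lambda>(x, \<omega>). z (max 0 x) \<omega>) \<in> borel_measurable (lborel \<Otimes>\<^sub>M M)"
  proof (rule borel_measurable_LIMSEQ_real)
    show "(\<lambda>(x, \<omega>). z (real (nat \<lceil>real (Suc n) * x\<rceil>) / real (Suc n)) \<omega>)
        \<in> borel_measurable (lborel \<Otimes>\<^sub>M M)" for n
    proof -
      have "(\<lambda>y. (\<lambda>y. nat \<lceil>real (Suc n) * fst y\<rceil>) y) \<in> lborel \<Otimes>\<^sub>M M \<rightarrow>\<^sub>M count_space UNIV"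
        by measurable
      moreover have "(\<lambda>y. z (real k / real (Suc n)) (snd y)) \<in> borel_measurable (lborel \<Otimes>\<^sub>M M)" for k
        by (rule measurable_compose[OF measurable_snd meas]) simp
      ultimately show ?thesis
        unfolding case_prod_beta
        by (rule measurable_compose_countable[rotated])
    qed
    fix y :: "real \<times> 'o" assume "y \<in> space (lborel \<Otimes>\<^sub>M M)"
    then obtain x \<omega> where y: "y = (x, \<omega>)" "\<omega> \<in> space M" by (auto simp: space_pair_measure)
    have "(\<lambda>n. real (nat \<lceil>real (Suc n) * x\<rceil>) / real (Suc n)) \<longlonglongrightarrow> max 0 x"
    proof (rule tendsto_sandwich)
      show "\<forall>\<^sub>F n in sequentially. max 0 x \<le> real (nat \<lceil>real (Suc n) * x\<rceil>) / real (Suc n)"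
      proof (intro always_eventually allI)
        fix n
        have "x * real (Suc n) \<le> real (nat \<lceil>real (Suc n) * x\<rceil>)"
          by (metis mult.commute real_nat_ceiling_ge)
        then show "max 0 x \<le> real (nat \<lceil>real (Suc n) * x\<rceil>) / real (Suc n)"
          by (subst pos_le_divide_eq) (auto simp: max_def)
      qed
      show "\<forall>\<^sub>F n in sequentially. real (nat \<lceil>real (Suc n) * x\<rceil>) / real (Suc n) \<le> max 0 x + 1 / real (Suc n)"
      proof (intro always_eventually allI)
        fix n
        have "real (nat \<lceil>real (Suc n) * x\<rceil>) \<le> max 0 (real (Suc n) * x) + 1"
          by (cases "0 \<le> real (Suc n) * x") (auto simp del: of_nat_Suc)
        also have "max 0 (real (Suc n) * x) = real (Suc n) * max 0 x"
          by (auto simp: max_def zero_le_mult_iff mult_le_0_iff)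
        finally show "real (nat \<lceil>real (Suc n) * x\<rceil>) / real (Suc n) \<le> max 0 x + 1 / real (Suc n)"
          by (simp add: divide_simps del: of_nat_Suc) (simp add: algebra_simps)
      qed
      show "(\<lambda>n. max 0 x + 1 / real (Suc n)) \<longlonglongrightarrow> max 0 x"
        using tendsto_add[OF tendsto_const LIMSEQ_inverse_real_of_nat, of "max 0 x"]
        by (simp add: inverse_eq_divide)
    qed simp
    from continuous_on_tendsto_compose[OF cont[OF y(2)] this]
    show "(\<lambda>n. case y of (x, \<omega>) \<Rightarrow> z (real (nat \<lceil>real (Suc n) * x\<rceil>) / real (Suc n)) \<omega>)
        \<longlonglongrightarrow> (case y of (x, \<omega>) \<Rightarrow> z (max 0 x) \<omega>)"
      using y by simp
  qed
  define g where "g = (\<lambda>(x, \<omega>). ennreal (z (max 0 x) \<omega> / x\<^sup>2) * indicator {0<..1} x)"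
  have g[measurable]: "g \<in> borel_measurable (lborel \<Otimes>\<^sub>M M)"
    using joint unfolding g_def case_prod_beta by measurable
  have eq: "(\<integral>\<^sup>+x\<in>{0<..1}. ennreal (z x \<omega> / x\<^sup>2) \<partial>lborel) = (\<integral>\<^sup>+x. g (x, \<omega>) \<partial>lborel)" for \<omega>
    by (intro nn_integral_cong) (auto simp: g_def indicator_def)
  show "(\<lambda>\<omega>. \<integral>\<^sup>+x\<in>{0<..1}. ennreal (z x \<omega> / x\<^sup>2) \<partial>lborel) \<in> borel_measurable M"
    unfolding eq by measurable
  have "(\<integral>\<^sup>+\<omega>. (\<integral>\<^sup>+x\<in>{0<..1}. ennreal (z x \<omega> / x\<^sup>2) \<partial>lborel) \<partial>M) = (\<integral>\<^sup>+x. (\<integral>\<^sup>+\<omega>. g (x, \<omega>) \<partial>M) \<partial>lborel)"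
    unfolding eq by (rule Fubini[OF g])
  also have "\<dots> \<le> (\<integral>\<^sup>+x. ennreal C * (ennreal (x powr (\<beta> - 2)) * indicator {0<..1} x) \<partial>lborel)"
  proof (rule nn_integral_mono)
    fix x :: real
    show "(\<integral>\<^sup>+\<omega>. g (x, \<omega>) \<partial>M) \<le> ennreal C * (ennreal (x powr (\<beta> - 2)) * indicator {0<..1} x)"
    proof (cases "x \<in> {0<..1}")
      case True
      then have [measurable]: "z x \<in> borel_measurable M" by (intro meas) auto
      have "(\<integral>\<^sup>+\<omega>. g (x, \<omega>) \<partial>M) = (\<integral>\<^sup>+\<omega>. ennreal (1 / x\<^sup>2) * ennreal (z x \<omega>) \<partial>M)"
        using True by (intro nn_integral_cong) (auto simp: g_def simp flip: ennreal_mult')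
      also have "\<dots> = ennreal (1 / x\<^sup>2) * (\<integral>\<^sup>+\<omega>. ennreal (z x \<omega>) \<partial>M)"
        by (rule nn_integral_cmult) simp
      also have "\<dots> \<le> ennreal (1 / x\<^sup>2) * ennreal (C * x powr \<beta>)"
        using True by (intro mult_left_mono bound) auto
      also have "\<dots> = ennreal C * ennreal (x powr (\<beta> - 2))"
        using True C by (simp add: powr_diff flip: ennreal_mult)
      finally show ?thesis using True by simp
    qed (simp add: g_def)
  qed
  also have "\<dots> = ennreal (C / (\<beta> - 1))"
    using nn_integral_powr_unit_interval[of "\<beta> - 2"] \<beta> C
    by (simp add: nn_integral_cmult flip: ennreal_mult)
  finally show "(\<integral>\<^sup>+\<omega>. (\<integral>\<^sup>+x\<in>{0<..1}. ennreal (z x \<omega> / x\<^sup>2) \<partial>lborel) \<partial>M) \<le> ennreal (C / (\<beta> - 1))" .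
qed

section \<open>A Hoelder constant valid with high probability\<close>

text \<open>Markov's inequality bounds the dyadic variation off a small event \<open>G\<close>;
  there chaining applies to the path rescaled from [0, \<tau>] to [0, 1].\<close>

lemma BM_Hoelder_with_high_probability:
  assumes M: "prob_space M" and BM: "standard_BM M B" and \<tau>: "0 < \<tau>" and \<delta>: "0 < \<delta>"
  obtains K G where "0 \<le> K" "G \<in> sets M" "emeasure M G \<le> ennreal \<delta>"
    "\<And>\<omega> s t. \<omega> \<in> space M - G \<Longrightarrow> 0 \<le> s \<Longrightarrow> s \<le> t \<Longrightarrow> t \<le> \<tau> \<Longrightarrow>
      \<bar>B t \<omega> - B s \<omega>\<bar> \<le> K * (t - s) powr (1 / 8)"
proof -
  \<comment> \<open>Exponent 1/8 gives \<open>2 * \<theta> ^ 4 = 2 powr (1 / 2)\<close>; any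
    exponent below 1/4 would keep this product above 1.\<close>
  define \<theta> :: real where "\<theta> = 2 powr - (1 / 8)"
  have th: "0 < \<theta>" "\<theta> < 1" by (auto simp: \<theta>_def powr_less_one)
  have "\<theta> ^ 4 = 2 powr - (1 / 2)" by (simp add: \<theta>_def powr_powr flip: powr_realpow)
  then have "2 * \<theta> ^ 4 = 2 powr (1 + - (1 / 2))" by (simp only: powr_add) simp
  then have th4: "1 < 2 * \<theta> ^ 4" by simp
  define Z where "Z = (\<lambda>\<omega>. dyadic_variation \<theta> \<tau> (\<lambda>t. B t \<omega>))"
  have [measurable]: "Z \<in> borel_measurable M" and "(\<integral>\<^sup>+\<omega>. Z \<omega> \<partial>M) < \<infinity>"
    using BM_dyadic_variation_finite_mean[OF BM \<tau> th(1) th4] by (auto simp: Z_def)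
  then obtain S where S: "(\<integral>\<^sup>+\<omega>. Z \<omega> \<partial>M) = ennreal S" "0 \<le> S"
    by (cases "\<integral>\<^sup>+\<omega>. Z \<omega> \<partial>M") auto
  \<comment> \<open>The summand 1 ensures \<open>1 \<le> C\<close>, whence
    \<open>C \<le> C ^ 4\<close> and the Markov bound \<open>S / C ^ 4\<close> is at most
    \<open>\<delta>\<close>.\<close>
  define C where "C = S / \<delta> + 1"
  have C: "1 \<le> C" using S \<delta> by (simp add: C_def)
  have "S / \<delta> \<le> C" by (simp add: C_def)
  also have "C \<le> C ^ 4" using C by (rule self_le_power) simp
  finally have CS: "1 / C ^ 4 * S \<le> \<delta>" using C \<delta> by (simp add: divide_simps mult.commute)
  define G where "G = {\<omega> \<in> space M. 1 \<le> ennreal (1 / C ^ 4) * Z \<omega>}"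
  \<comment> \<open>The last factor undoes the rescaling of time by \<tau>.\<close>
  define K where "K = 3 * C * 2 powr (1 / 8) / (1 - \<theta>) * \<tau> powr - (1 / 8)"
  show thesis
  proof (rule that)
    show "0 \<le> K" using C th by (simp add: K_def)
    show "G \<in> sets M" unfolding G_def by measurable
    have "emeasure M G \<le> ennreal (1 / C ^ 4) * (\<integral>\<^sup>+\<omega>. Z \<omega> * indicator (space M) \<omega> \<partial>M)"
      unfolding G_def by (rule nn_integral_Markov_inequality) auto
    also have "(\<integral>\<^sup>+\<omega>. Z \<omega> * indicator (space M) \<omega> \<partial>M) = ennreal S"
      unfolding S(1)[symmetric] by (intro nn_integral_cong) auto
    also have "ennreal (1 / C ^ 4) * ennreal S \<le> ennreal \<delta>"
      using CS C S by (subst ennreal_mult[symmetric]) (auto intro: ennreal_leI)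
    finally show "emeasure M G \<le> ennreal \<delta>" .
    fix \<omega> s t assume \<omega>: "\<omega> \<in> space M - G" and st: "0 \<le> s" "s \<le> t" "t \<le> \<tau>"
    have "Z \<omega> \<le> ennreal (C ^ 4)"
    proof (cases "Z \<omega>")
      case (real z)
      then have "\<not> 1 \<le> 1 / C ^ 4 * z"
        using \<omega> C by (simp add: G_def flip: ennreal_mult ennreal_1)
      then show ?thesis using C real by (auto simp: divide_simps intro: ennreal_leI)
    next
      case top
      then show ?thesis using \<omega> C by (simp add: G_def ennreal_mult_top)
    qed
    then have incr: "\<bar>B (\<tau> * (real (Suc k) / 2 ^ n)) \<omega> - B (\<tau> * (real k / 2 ^ n)) \<omega>\<bar> \<le> C * \<theta> ^ n"
      if "k < 2 ^ n" for n k
      unfolding Z_def using dyadic_increment_le[of \<theta> \<tau> "\<lambda>t. B t \<omega>" C] C th(1) that by simp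
    have cont: "continuous_on {0..} (\<lambda>t. B t \<omega>)" using BM \<omega> by (auto simp: standard_BM_def)
    have "\<bar>B (\<tau> * (t / \<tau>)) \<omega> - B (\<tau> * (s / \<tau>)) \<omega>\<bar>
        \<le> 3 * C * 2 powr (1 / 8) / (1 - 2 powr - (1 / 8)) * (t / \<tau> - s / \<tau>) powr (1 / 8)"
    proof (rule dyadic_Hoelder_powr)
      show "continuous_on {0..1} (\<lambda>u. B (\<tau> * u) \<omega>)"
        using \<tau> by (intro continuous_on_compose2[OF cont] continuous_intros) auto
    qed (use C st \<tau> incr in \<open>auto simp: \<theta>_def divide_right_mono\<close>)
    also have "\<dots> = K * (t - s) powr (1 / 8)"
      using st \<tau> by (simp add: K_def \<theta>_def powr_divide powr_minus_divide flip: diff_divide_distrib)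
    finally show "\<bar>B t \<omega> - B s \<omega>\<bar> \<le> K * (t - s) powr (1 / 8)"
      using \<tau> by simp
  qed
qed

section \<open>Uniform bounds and tools for convergence in probability\<close>

text \<open>The variance is at most the second moment, once finiteness of the latter makes the
  Bochner integrals genuine ones rather than default values.\<close>

lemma limit_sd_bounded:
  assumes V: "real_distribution V" and lam: "0 \<le> lam" and S: "(\<integral>\<^sup>+y. ennreal (y\<^sup>2) \<partial>V) \<le> ennreal S" "0 \<le> S"
  shows "limit_sd lam sigA V \<le> sqrt (lam * S + lam * sigA\<^sup>2)"
proof -
  interpret real_distribution V by (rule V)
  have sq: "integrable V (\<lambda>y. y\<^sup>2)"
    by (rule integrableI_bounded) (use S in \<open>auto simp: le_less_trans\<close>)
  have int: "integrable V (\<lambda>y. y)"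
    by (rule square_integrable_imp_integrable[OF _ sq]) simp
  have "law_variance V = variance (\<lambda>y. y)"
    by (simp add: law_variance_def law_mean_def)
  also have "\<dots> \<le> expectation (\<lambda>y. y\<^sup>2)"
    by (subst variance_eq[OF int sq]) simp
  also have "\<dots> \<le> S"
    using S nn_integral_eq_integral[OF sq] by simp
  finally show ?thesis
    unfolding limit_sd_def using lam by (intro real_sqrt_le_mono add_right_mono mult_left_mono)
qed

lemma ennreal_tendsto_0I:
  fixes f :: "'a \<Rightarrow> ennreal"
  assumes "\<And>\<delta>. 0 < \<delta> \<Longrightarrow> \<forall>\<^sub>F x in F. f x \<le> ennreal \<delta>"
  shows "(f \<longlongrightarrow> 0) F"
proof (rule order_tendstoI)
  fix a :: ennreal assume "0 < a"
  \<comment> \<open>A value strictly below \<open>a\<close> is finite even if \<open>a\<close> is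
    infinite.\<close>
  then obtain b where b: "0 < b" "b < a" using dense by blast
  then obtain \<delta> where "b = ennreal \<delta>" "0 < \<delta>"
    by (cases b) (auto simp: ennreal_zero_less_top)
  with assms[of \<delta>] b show "\<forall>\<^sub>F x in F. f x < a"
    by (auto elim: eventually_mono)
qed simp

lemma emeasure_Markov_le:
  assumes "u \<in> borel_measurable M" "(\<integral>\<^sup>+\<omega>. u \<omega> \<partial>M) \<le> ennreal I" "0 \<le> I" "0 \<le> c" "c * I \<le> \<delta>"
  shows "emeasure M {\<omega> \<in> space M. 1 \<le> ennreal c * u \<omega>} \<le> ennreal \<delta>"
proof -
  have "emeasure M {\<omega> \<in> space M. 1 \<le> ennreal c * u \<omega>}
      \<le> ennreal c * (\<integral>\<^sup>+\<omega>. u \<omega> * indicator (space M) \<omega> \<partial>M)"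
    using assms(1) by (intro nn_integral_Markov_inequality) auto
  also have "(\<integral>\<^sup>+\<omega>. u \<omega> * indicator (space M) \<omega> \<partial>M) = (\<integral>\<^sup>+\<omega>. u \<omega> \<partial>M)"
    by (intro nn_integral_cong) auto
  also have "ennreal c * (\<integral>\<^sup>+\<omega>. u \<omega> \<partial>M) \<le> ennreal c * ennreal I"
    using assms(2) by (rule mult_left_mono) simp
  also have "\<dots> \<le> ennreal \<delta>"
    using assms by (subst ennreal_mult[symmetric]) (auto intro: ennreal_leI)
  finally show ?thesis .
qed

text \<open>The event of the conclusion involves an uncountable supremum; a measurable superset
  controls its outer measure without a proof that it is measurable.\<close>

lemma outer_measure_of_le:
  assumes "A \<subseteq> E" "E \<in> sets M" "emeasure M E \<le> c"
  shows "outer_measure_of M A \<le> c"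
  using outer_measure_of_mono[OF assms(1), of M] outer_measure_of_eq[OF assms(2)] assms(3) by simp

text \<open>Multiplication by \<open>a powr (p - \<eta>)\<close> cancels the weight inside the
  supremum; the factor 2 in \<open>C0\<close> only enlarges the bound.\<close>

lemma nn_integral_le_of_C0:
  assumes "C0 M z p \<eta> \<le> ennreal C" "0 \<le> C" "0 < a"
  shows "(\<integral>\<^sup>+\<omega>. ennreal (z a \<omega>) \<partial>M) \<le> ennreal (C * a powr (p - \<eta>))"
proof -
  let ?I = "\<integral>\<^sup>+\<omega>. ennreal (z a \<omega>) \<partial>M"
  have "ennreal (a powr (- (p - \<eta>))) * ?I \<le> (SUP a\<in>{0<..}. ennreal (a powr (- (p - \<eta>))) * (\<integral>\<^sup>+\<omega>. ennreal (z a \<omega>) \<partial>M))"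
    using assms(3) by (intro SUP_upper) auto
  also have "\<dots> \<le> C0 M z p \<eta>" unfolding C0_def mult_2 by simp
  also note assms(1)
  finally have "ennreal (a powr (p - \<eta>)) * (ennreal (a powr (- (p - \<eta>))) * ?I) \<le> ennreal (a powr (p - \<eta>)) * ennreal C"
    by (rule mult_left_mono) simp
  also have "ennreal (a powr (p - \<eta>)) * (ennreal (a powr (- (p - \<eta>))) * ?I) = ?I"
    unfolding mult.assoc[symmetric] using assms(3) by (simp flip: ennreal_mult powr_add)
  also have "ennreal (a powr (p - \<eta>)) * ennreal C = ennreal (C * a powr (p - \<eta>))"
    using assms(2) by (simp add: mult.commute flip: ennreal_mult)
  finally show ?thesis .
qed

lemma SUP_ennreal_finiteE:
  fixes f :: "'a \<Rightarrow> ennreal"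
  assumes "(SUP x\<in>A. f x) < \<infinity>"
  obtains C where "0 \<le> C" "\<And>x. x \<in> A \<Longrightarrow> f x \<le> ennreal C"
proof -
  obtain C where "(SUP x\<in>A. f x) = ennreal C" "0 \<le> C"
    using assms by (cases "SUP x\<in>A. f x") auto
  then show thesis using that by (metis SUP_upper)
qed

section \<open>Convergence in probability\<close>

theorem theorem5:
  fixes rs :: "nat \<Rightarrow> real"
    and N :: "nat \<Rightarrow> 'w measure"
    and T :: "nat \<Rightarrow> nat \<Rightarrow> 'w \<Rightarrow> real"
    and lamr sigAr :: "nat \<Rightarrow> real"
    and V :: "real \<Rightarrow> real measure"
    and v :: "real \<Rightarrow> nat \<Rightarrow> nat \<Rightarrow> 'w \<Rightarrow> real"
    and q :: "real \<Rightarrow> nat \<Rightarrow> 'w \<Rightarrow> nat"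
    and b :: "real \<Rightarrow> nat \<Rightarrow> nat \<Rightarrow> 'w \<Rightarrow> real"
    and srv :: "real \<Rightarrow> nat \<Rightarrow> 'w \<Rightarrow> real \<Rightarrow> (nat + nat) option"
    and \<kappa> lam sigA :: real
    and M :: "'o measure"
    and B :: "real \<Rightarrow> 'o \<Rightarrow> real"
    and xi :: "real \<Rightarrow> real \<Rightarrow> 'o \<Rightarrow> real"
    and xi_inf :: "real \<Rightarrow> 'o \<Rightarrow> real"
    and \<eta> :: "real \<Rightarrow> real"
    and \<tau> :: real
  assumes setting: "srpt_family rs N T lamr sigAr V v q b srv \<kappa> lam sigA M B xi xi_inf"
    and eta: "\<And>p. 2 \<le> p \<Longrightarrow> admissible_eta rs N (V p) (q p) (b p) p (\<eta> p)"
    and eta_growth: "Liminf at_top (\<lambda>p. ereal ((p - 1 - \<eta> p) / ln p)) = \<infinity>"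
    and sup_second_moment: "(SUP p\<in>{2..}. \<integral>\<^sup>+y. ennreal (y\<^sup>2) \<partial>V p) < \<infinity>"
    and sup_xi_inf: "(SUP p\<in>{2..}. \<integral>\<^sup>+\<omega>. ennreal (xi_inf p \<omega>) \<partial>M) < \<infinity>"
    and sup_C0: "(SUP p\<in>{2..}. C0 M (xi p) p (\<eta> p)) < \<infinity>"
    and xi_tail: "\<And>a. 1 < a \<Longrightarrow> ((\<lambda>p. \<integral>\<omega>. xi_inf p \<omega> - xi p a \<omega> \<partial>M) \<longlongrightarrow> 0) at_top"
    and tau: "0 < \<tau>"
  shows "conv_in_prob_0 (\<lambda>p. M)
    (\<lambda>p \<omega>. SUP t\<in>{0..\<tau>}.
      \<bar>enn2ereal (limit_queue p \<kappa> lam (limit_sd lam sigA (V p)) (\<lambda>a. xi p a \<omega>) (\<lambda>s. B s \<omega>) t)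
        - ereal (limit_workload \<kappa> (limit_sd lam sigA (V p)) (xi_inf p \<omega>) (\<lambda>s. B s \<omega>) t)\<bar>)
    at_top"
proof -
  interpret srpt_family rs N T lamr sigAr V v q b srv \<kappa> lam sigA M B xi xi_inf
    by (rule setting)
  interpret prob_space M by (rule prob_space_M)
  obtain S where S: "0 \<le> S" "\<And>p. 2 \<le> p \<Longrightarrow> (\<integral>\<^sup>+y. ennreal (y\<^sup>2) \<partial>V p) \<le> ennreal S"
    using SUP_ennreal_finiteE[OF sup_second_moment] by (metis atLeast_iff)
  obtain C1 where C1: "0 \<le> C1" "\<And>p. 2 \<le> p \<Longrightarrow> (\<integral>\<^sup>+\<omega>. ennreal (xi_inf p \<omega>) \<partial>M) \<le> ennreal C1"
    using SUP_ennreal_finiteE[OF sup_xi_inf] by (metis atLeast_iff)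
  obtain C2 where C2: "0 \<le> C2" "\<And>p. 2 \<le> p \<Longrightarrow> C0 M (xi p) p (\<eta> p) \<le> ennreal C2"
    using SUP_ennreal_finiteE[OF sup_C0] by (metis atLeast_iff)
  define \<sigma> where "\<sigma> = (\<lambda>p. limit_sd lam sigA (V p))"
  define \<sigma>max where "\<sigma>max = sqrt (lam * S + lam * sigA\<^sup>2)"
  have \<sigma>: "0 \<le> \<sigma> p" "\<sigma> p \<le> \<sigma>max" if "2 \<le> p" for p
  proof -
    have "0 \<le> law_variance (V p)" unfolding law_variance_def by simp
    then show "0 \<le> \<sigma> p" using lam_pos by (simp add: \<sigma>_def limit_sd_def)
    show "\<sigma> p \<le> \<sigma>max"
      using limit_sd_bounded[OF law_prob[OF that] _ S(2)[OF that] S(1)] lam_pos by (simp add: \<sigma>_def \<sigma>max_def)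
  qed
  have xi_le: "xi p x \<omega> \<le> xi_inf p \<omega>" if "2 \<le> p" "0 \<le> x" "\<omega> \<in> space M" for p x \<omega>
  proof (rule tendsto_lowerbound[OF xi_inf_lim[OF that(1,3)]])
    show "\<forall>\<^sub>F a in at_top. xi p x \<omega> \<le> xi p a \<omega>"
      using eventually_ge_at_top[of x]
      by eventually_elim (use xi_mono[OF that(1,3)] that(2) in \<open>auto intro: mono_onD\<close>)
  qed simp
  \<comment> \<open>Eventually the quotient exceeds 1, so that \<open>p - 1 - \<eta> p\<close>
    dominates \<open>ln p\<close>.\<close>
  have rate: "filterlim (\<lambda>p. p - 1 - \<eta> p) at_top at_top"
  proof (rule filterlim_at_top_mono[OF ln_at_top])
    have "\<forall>\<^sub>F p in at_top. 1 < ereal ((p - 1 - \<eta> p) / ln p)"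
      by (rule less_LiminfD) (simp add: eta_growth)
    then show "\<forall>\<^sub>F p in at_top. ln p \<le> p - 1 - \<eta> p"
      using eventually_gt_at_top[of 1]
      by eventually_elim (simp add: one_ereal_def less_divide_eq)
  qed
  show ?thesis
    unfolding conv_in_prob_0_def
  proof (intro allI impI ennreal_tendsto_0I)
    fix e \<delta>' :: real assume e: "0 < e" and "0 < \<delta>'"
    \<comment> \<open>One quarter for each of the exceptional events \<open>G\<close>,
      \<open>E1\<close>, \<open>E2\<close> and \<open>E3\<close>.\<close>
    define \<delta> where "\<delta> = \<delta>' / 4"
    have \<delta>: "0 < \<delta>" using \<open>0 < \<delta>'\<close> by (simp add: \<delta>_def)
    obtain K G where K: "0 \<le> K" and G: "G \<in> sets M" "emeasure M G \<le> ennreal \<delta>"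
      and H: "\<And>\<omega> s t. \<omega> \<in> space M - G \<Longrightarrow> 0 \<le> s \<Longrightarrow> s \<le> t \<Longrightarrow> t \<le> \<tau> \<Longrightarrow>
        \<bar>B t \<omega> - B s \<omega>\<bar> \<le> K * (t - s) powr (1 / 8)"
      by (rule BM_Hoelder_with_high_probability[OF prob_space_M BM tau \<delta>]) blast
    \<comment> \<open>The second summand absorbs the drift: for t - s \<le> \<tau>, one has
      \<open>t - s \<le> \<tau> powr (7 / 8) * (t - s) powr (1 / 8)\<close>. Neither summand depends
      on \<open>p\<close>.\<close>
    define A where "A = \<sigma>max * K + \<bar>\<kappa>\<bar> * \<tau> powr (7 / 8)"
    have \<sigma>max: "0 \<le> \<sigma>max" using \<sigma>[of 2] by simp
    have A: "0 \<le> A" using \<sigma>max K by (simp add: A_def)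
    have Hoelder: "\<sigma> p * (B t \<omega> - B s \<omega>) + \<kappa> * (t - s) \<le> A * (t - s) powr (1 / 8)"
      if p: "2 \<le> p" and \<omega>: "\<omega> \<in> space M - G" and st: "0 \<le> s" "s \<le> t" "t \<le> \<tau>" for p \<omega> s t
    proof -
      have "\<sigma> p * (B t \<omega> - B s \<omega>) \<le> \<sigma> p * (K * (t - s) powr (1 / 8))"
        using H[OF \<omega> st] \<sigma>[OF p] by (intro mult_left_mono) auto
      also have "\<dots> \<le> \<sigma>max * (K * (t - s) powr (1 / 8))"
        using \<sigma>[OF p] K by (intro mult_right_mono) auto
      finally have 1: "\<sigma> p * (B t \<omega> - B s \<omega>) \<le> \<sigma>max * (K * (t - s) powr (1 / 8))" .
      have "t - s = (t - s) powr (7 / 8) * (t - s) powr (1 / 8)"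
        using st by (simp flip: powr_add)
      also have "\<dots> \<le> \<tau> powr (7 / 8) * (t - s) powr (1 / 8)"
        using st by (intro mult_right_mono powr_mono2) auto
      finally have "\<bar>\<kappa>\<bar> * (t - s) \<le> \<bar>\<kappa>\<bar> * (\<tau> powr (7 / 8) * (t - s) powr (1 / 8))"
        by (rule mult_left_mono) simp
      moreover have "\<kappa> * (t - s) \<le> \<bar>\<kappa>\<bar> * (t - s)" using st by (intro mult_right_mono) auto
      ultimately show ?thesis using 1 by (simp add: A_def algebra_simps)
    qed
    \<comment> \<open>Chosen so that Markov's inequality for \<open>xi_inf p\<close> gives
      probability at most \<open>\<delta>\<close> to \<open>E2\<close>, uniformly in
      \<open>p\<close>; the 1 added to \<open>C1\<close> prevents a zero denominator. As
      \<open>a\<close> is fixed before \<open>p\<close> grows, \<open>xi_tail\<close> applies to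
      it.\<close>
    define a where "a = 1 + \<delta> * e / (8 * (C1 + 1))"
    have a: "1 < a" using \<delta> e C1(1) by (simp add: a_def)
    have a_small: "8 * (a - 1) / e * C1 \<le> \<delta>"
    proof -
      have "8 * (a - 1) / e * C1 = \<delta> * (C1 / (C1 + 1))" using e C1(1) by (simp add: a_def divide_simps)
      also have "\<dots> \<le> \<delta> * 1" using C1(1) \<delta> by (intro mult_left_mono) auto
      finally show ?thesis by simp
    qed
    \<comment> \<open>The deterministic part of the error is of order 1 / p and receives one quarter
      of \<open>e\<close>; the three random parts receive the others.\<close>
    have "((\<lambda>p. A * (A / lam) powr (1 / 7) / (p / 7 - 1) + 2 * lam * \<tau> / (p + 1)) \<longlongrightarrow> 0) at_top"
      by real_asymp
    then have ev1: "\<forall>\<^sub>F p in at_top. A * (A / lam) powr (1 / 7) / (p / 7 - 1) + 2 * lam * \<tau> / (p + 1) < e / 4"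
      using e by (intro order_tendstoD) auto
    have "((\<lambda>p. 4 / e * (C2 / (p - 1 - \<eta> p))) \<longlongrightarrow> 4 / e * 0) at_top"
      by (intro tendsto_mult tendsto_const tendsto_divide_0[OF tendsto_const filterlim_at_top_imp_at_infinity[OF rate]])
    then have ev2: "\<forall>\<^sub>F p in at_top. 4 / e * (C2 / (p - 1 - \<eta> p)) < \<delta>"
      using \<delta> by (intro order_tendstoD) auto
    have "((\<lambda>p. 8 / e * (\<integral>\<omega>. xi_inf p \<omega> - xi p a \<omega> \<partial>M)) \<longlongrightarrow> 8 / e * 0) at_top"
      by (intro tendsto_mult tendsto_const xi_tail a)
    then have ev3: "\<forall>\<^sub>F p in at_top. 8 / e * (\<integral>\<omega>. xi_inf p \<omega> - xi p a \<omega> \<partial>M) < \<delta>"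
      using \<delta> by (intro order_tendstoD) auto
    show "\<forall>\<^sub>F p in at_top. outer_measure_of M {\<omega> \<in> space M. ereal e < (SUP t\<in>{0..\<tau>}.
      \<bar>enn2ereal (limit_queue p \<kappa> lam (limit_sd lam sigA (V p)) (\<lambda>a. xi p a \<omega>) (\<lambda>s. B s \<omega>) t)
        - ereal (limit_workload \<kappa> (limit_sd lam sigA (V p)) (xi_inf p \<omega>) (\<lambda>s. B s \<omega>) t)\<bar>)} \<le> ennreal \<delta>'"
      using eventually_gt_at_top[of 7] ev1 ev2 ev3
    proof eventually_elim
      fix p :: real
      assume p7: "7 < p"
        and small1: "A * (A / lam) powr (1 / 7) / (p / 7 - 1) + 2 * lam * \<tau> / (p + 1) < e / 4"
        and small2: "4 / e * (C2 / (p - 1 - \<eta> p)) < \<delta>"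
        and small3: "8 / e * (\<integral>\<omega>. xi_inf p \<omega> - xi p a \<omega> \<partial>M) < \<delta>"
      then have p: "2 \<le> p" by simp
      have \<beta>: "1 < p - \<eta> p" using eta[OF p] by (auto simp: admissible_eta_def)
      define Y where "Y = (\<lambda>\<omega>. \<integral>\<^sup>+x\<in>{0<..1}. ennreal (xi p x \<omega> / x\<^sup>2) \<partial>lborel)"
      have Y[measurable]: "Y \<in> borel_measurable M" and
        Y_mean: "(\<integral>\<^sup>+\<omega>. Y \<omega> \<partial>M) \<le> ennreal (C2 / (p - \<eta> p - 1))"
        using nn_integral_small_sizes[where z = "xi p" and C = C2 and \<beta> = "p - \<eta> p",
            OF prob_space_M xi_meas[OF p] xi_cont[OF p] nn_integral_le_of_C0[OF C2(2)[OF p] C2(1)] C2(1) \<beta>]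
        by (auto simp: Y_def)
      have [measurable]: "xi_inf p \<in> borel_measurable M" "xi p a \<in> borel_measurable M"
        using xi_inf_integrable[OF p] xi_meas[OF p] a by auto
      have a_ge_0: "0 \<le> a" using a by simp
      have int_a: "integrable M (xi p a)"
        by (rule Bochner_Integration.integrable_bound[OF xi_inf_integrable[OF p]])
           (use xi_le[OF p a_ge_0] xi_nonneg[OF p a_ge_0] in \<open>auto intro!: AE_I2 intro: order_trans[OF _ abs_ge_self]\<close>)
      have gap: "(\<integral>\<^sup>+\<omega>. ennreal (xi_inf p \<omega> - xi p a \<omega>) \<partial>M) = ennreal (\<integral>\<omega>. xi_inf p \<omega> - xi p a \<omega> \<partial>M)"
        using xi_le[OF p a_ge_0] by (intro nn_integral_eq_integral) (auto simp: xi_inf_integrable[OF p] int_a)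
      have gap0: "0 \<le> (\<integral>\<omega>. xi_inf p \<omega> - xi p a \<omega> \<partial>M)"
        using xi_le[OF p a_ge_0] by (intro integral_nonneg_AE AE_I2) auto
      \<comment> \<open>Off these events the small-size integral,
        \<open>2 * (a - 1) * xi_inf p \<omega>\<close> and
        \<open>2 * (xi_inf p \<omega> - xi p a \<omega>)\<close> are each below
        \<open>e / 4\<close>.\<close>
      define E1 where "E1 = {\<omega> \<in> space M. 1 \<le> ennreal (4 / e) * Y \<omega>}"
      define E2 where "E2 = {\<omega> \<in> space M. 1 \<le> ennreal (8 * (a - 1) / e) * ennreal (xi_inf p \<omega>)}"
      define E3 where "E3 = {\<omega> \<in> space M. 1 \<le> ennreal (8 / e) * ennreal (xi_inf p \<omega> - xi p a \<omega>)}"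
      have E1: "E1 \<in> sets M" "emeasure M E1 \<le> ennreal \<delta>"
        unfolding E1_def using Y_mean \<beta> C2(1) e small2
        by (measurable, intro emeasure_Markov_le[where I = "C2 / (p - \<eta> p - 1)"]) (auto simp: algebra_simps)
      have E2: "E2 \<in> sets M" "emeasure M E2 \<le> ennreal \<delta>"
        unfolding E2_def using C1 p a e a_small
        by (measurable, intro emeasure_Markov_le[where I = C1]) auto
      have E3: "E3 \<in> sets M" "emeasure M E3 \<le> ennreal \<delta>"
        unfolding E3_def using gap gap0 e small3
        by (measurable, intro emeasure_Markov_le[where I = "\<integral>\<omega>. xi_inf p \<omega> - xi p a \<omega> \<partial>M"]) auto
      show "outer_measure_of M {\<omega> \<in> space M. ereal e < (SUP t\<in>{0..\<tau>}.
        \<bar>enn2ereal (limit_queue p \<kappa> lam (limit_sd lam sigA (V p)) (\<lambda>a. xi p a \<omega>) (\<lambda>s. B s \<omega>) t)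
          - ereal (limit_workload \<kappa> (limit_sd lam sigA (V p)) (xi_inf p \<omega>) (\<lambda>s. B s \<omega>) t)\<bar>)} \<le> ennreal \<delta>'"
      proof (rule outer_measure_of_le)
        show "G \<union> E1 \<union> E2 \<union> E3 \<in> sets M" using G(1) E1(1) E2(1) E3(1) by blast
        have "emeasure M (G \<union> E1 \<union> E2 \<union> E3)
            \<le> emeasure M G + emeasure M E1 + emeasure M E2 + emeasure M E3"
          using G(1) E1(1) E2(1) E3(1)
          by (intro order_trans[OF emeasure_subadditive] add_mono) auto
        also have "\<dots> \<le> ennreal \<delta> + ennreal \<delta> + ennreal \<delta> + ennreal \<delta>"
          using G(2) E1(2) E2(2) E3(2) by (intro add_mono)
        also have "\<dots> = ennreal \<delta>'" using \<delta> by (simp add: \<delta>_def flip: ennreal_plus)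
        finally show "emeasure M (G \<union> E1 \<union> E2 \<union> E3) \<le> ennreal \<delta>'" .
        show "{\<omega> \<in> space M. ereal e < (SUP t\<in>{0..\<tau>}.
          \<bar>enn2ereal (limit_queue p \<kappa> lam (limit_sd lam sigA (V p)) (\<lambda>a. xi p a \<omega>) (\<lambda>s. B s \<omega>) t)
            - ereal (limit_workload \<kappa> (limit_sd lam sigA (V p)) (xi_inf p \<omega>) (\<lambda>s. B s \<omega>) t)\<bar>)}
          \<subseteq> G \<union> E1 \<union> E2 \<union> E3"
        proof (rule subsetI, rule ccontr)
          fix \<omega>
          assume "\<omega> \<in> {\<omega> \<in> space M. ereal e < (SUP t\<in>{0..\<tau>}.
            \<bar>enn2ereal (limit_queue p \<kappa> lam (limit_sd lam sigA (V p)) (\<lambda>a. xi p a \<omega>) (\<lambda>s. B s \<omega>) t)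
              - ereal (limit_workload \<kappa> (limit_sd lam sigA (V p)) (xi_inf p \<omega>) (\<lambda>s. B s \<omega>) t)\<bar>)}"
            and good: "\<omega> \<notin> G \<union> E1 \<union> E2 \<union> E3"
          then have \<omega>: "\<omega> \<in> space M" and big: "ereal e < (SUP t\<in>{0..\<tau>}.
            \<bar>enn2ereal (limit_queue p \<kappa> lam (\<sigma> p) (\<lambda>a. xi p a \<omega>) (\<lambda>s. B s \<omega>) t)
              - ereal (limit_workload \<kappa> (\<sigma> p) (xi_inf p \<omega>) (\<lambda>s. B s \<omega>) t)\<bar>)"
            by (auto simp: \<sigma>_def)
          have xi0: "0 \<le> xi_inf p \<omega>" "xi p a \<omega> \<le> xi_inf p \<omega>"
            using xi_le[OF p a_ge_0 \<omega>] xi_nonneg[OF p a_ge_0 \<omega>] by auto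
          \<comment> \<open>An infinite value of \<open>Y \<omega>\<close> would put \<omega> into
            \<open>E1\<close>.\<close>
          obtain y where y: "Y \<omega> = ennreal y" "0 \<le> y" "y \<le> e / 4"
          proof (cases "Y \<omega>")
            case (real y)
            then have "\<not> 1 \<le> 4 / e * y"
              using good \<omega> e by (simp add: E1_def flip: ennreal_mult ennreal_1)
            then show thesis using that[of y] real e by (auto simp: divide_simps)
          next
            case top
            then show thesis using good \<omega> e by (simp add: E1_def ennreal_mult_top)
          qed
          have "\<not> 1 \<le> 8 * (a - 1) / e * xi_inf p \<omega>"
            using good \<omega> e a xi0 by (simp add: E2_def flip: ennreal_mult ennreal_1)
          then have 2: "2 * (a - 1) * xi_inf p \<omega> \<le> e / 4"
            using e by (simp add: divide_simps algebra_simps)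
          have "\<not> 1 \<le> 8 / e * (xi_inf p \<omega> - xi p a \<omega>)"
            using good \<omega> e xi0 by (simp add: E3_def flip: ennreal_mult ennreal_1)
          then have 3: "2 * (xi_inf p \<omega> - xi p a \<omega>) \<le> e / 4"
            using e by (simp add: divide_simps)
          have "(SUP t\<in>{0..\<tau>}.
            \<bar>enn2ereal (limit_queue p \<kappa> lam (\<sigma> p) (\<lambda>a. xi p a \<omega>) (\<lambda>s. B s \<omega>) t)
              - ereal (limit_workload \<kappa> (\<sigma> p) (xi_inf p \<omega>) (\<lambda>s. B s \<omega>) t)\<bar>) \<le> ereal e"
          proof (rule SUP_least)
            fix t assume t: "t \<in> {0..\<tau>}"
            have "\<bar>enn2ereal (limit_queue p \<kappa> lam (\<sigma> p) (\<lambda>a. xi p a \<omega>) (\<lambda>s. B s \<omega>) t)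
                - ereal (limit_workload \<kappa> (\<sigma> p) (xi_inf p \<omega>) (\<lambda>s. B s \<omega>) t)\<bar>
              \<le> enn2ereal (Y \<omega>) + ereal (A * (A / lam) powr (1 / 7) / (p / 7 - 1)
                + 2 * lam * \<tau> / (p + 1) + 2 * (a - 1) * xi_inf p \<omega> + 2 * (xi_inf p \<omega> - xi p a \<omega>))"
              unfolding Y_def
            proof (rule limit_queue_close_to_workload)
              show "B 0 \<omega> = 0" "continuous_on {0..} (\<lambda>s. B s \<omega>)"
                using BM \<omega> by (auto simp: standard_BM_def)
              show "\<sigma> p * (B t \<omega> - B s \<omega>) + \<kappa> * (t - s) \<le> A * (t - s) powr (1 / 8)"
                if "0 \<le> s" "s \<le> t" "t \<le> \<tau>" for s t
                using good \<omega> that by (intro Hoelder p) auto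
            qed (use xi_cont[OF p \<omega>] xi_mono[OF p \<omega>] xi_nonneg[OF p _ \<omega>] xi_le[OF p _ \<omega>] lam_pos p7 a A t in auto)
            also have "\<dots> = ereal (y + (A * (A / lam) powr (1 / 7) / (p / 7 - 1)
                + 2 * lam * \<tau> / (p + 1) + 2 * (a - 1) * xi_inf p \<omega> + 2 * (xi_inf p \<omega> - xi p a \<omega>)))"
              using y by (simp add: enn2ereal_ennreal)
            also have "\<dots> \<le> ereal e"
              unfolding ereal_less_eq using y 2 3 small1 by linarith
            finally show "\<bar>enn2ereal (limit_queue p \<kappa> lam (\<sigma> p) (\<lambda>a. xi p a \<omega>) (\<lambda>s. B s \<omega>) t)
                - ereal (limit_workload \<kappa> (\<sigma> p) (xi_inf p \<omega>) (\<lambda>s. B s \<omega>) t)\<bar> \<le> ereal e" .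
          qed
          with big show False by (simp add: leD)
        qed
      qed
    qed
  qed
qed

end
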